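(* Let $c\in\mathbb{F}\setminus\{0\}$, let $j\in\mathbb{N}\setminus\{0\}$, let $d\in\mathbb{F}[\alpha_1,\ldots,\alpha_n]$ be an irreducible polynomial with $d\nsim_\sigma\alpha_n$, and let $a\in\mathbb{F}(\alpha_1,\ldots,\alpha_{n-1})[\alpha_n]$ with $\deg_{\alpha_n}(a)<\deg_{\alpha_n}(d)$. Put $f=\frac{a}{d^j}$. Suppose $\mathrm{Spr}_\sigma(d,d)=k\mathbb{Z}$ for some $k\in\mathbb{N}\setminus\{0\}$ and $\sigma^k(d)=ud$ for some $u\in\mathbb{F}\setminus\{0\}$. Then $f$ is $c\sigma$-summable in $\mathbb{F}(\alpha_1,\ldots,\alpha_n)$ if and only if $a=\varepsilon\sigma^k(b)-b$ for some $b\in\mathbb{F}(\alpha_1,\ldots,\alpha_{n-1})[\alpha_n]$ with $\deg_{\alpha_n}(b)<\deg_{\alpha_n}(d)$, where $\varepsilon=c^ku^{-j}$.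
   Context: $\mathbb{F}$ is a subfield of $\overline{\mathbb{Q}}$, $n\ge1$, $\lambda_1,\ldots,\lambda_n\in\mathbb{F}\setminus\{0\}$, and $\sigma$ is the field automorphism of the rational function field $\mathbb{F}(\alpha_1,\ldots,\alpha_n)$ with $\sigma|_{\mathbb{F}}=\mathrm{id}$ and $\sigma(\alpha_i)=\lambda_i\alpha_i$. For $n=1$, $\mathbb{F}(\alpha_1,\ldots,\alpha_{n-1})$ means $\mathbb{F}$. The degree of the zero polynomial is $-\infty$. For polynomials $p,q\in\mathbb{F}[\alpha_1,\ldots,\alpha_n]$, $\mathrm{Spr}_\sigma(p,q)=\{k\in\mathbb{Z}\mid\sigma^k(p)=c'q\text{ for some }c'\in\mathbb{F}\setminus\{0\}\}$; one writes $p\sim_\sigma q$ if $\mathrm{Spr}_\sigma(p,q)\ne\emptyset$ and $p\nsim_\sigma q$ otherwise. A rational function $f$ is $c\sigma$-summable in $\mathbb{F}(\alpha_1,\ldots,\alpha_n)$ if $f=c\sigma(g)-g$ for some $g\in\mathbb{F}(\alpha_1,\ldots,\alpha_n)$. *)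

theory Defs
  imports
    Complex_Main
    "HOL-Library.Poly_Mapping"
    "HOL-Library.Extended_Real"
    "HOL-Computational_Algebra.Polynomial"
    "HOL-Computational_Algebra.Fraction_Field"
begin

text \<open>
  The algebraic closure of the rationals is the set of algebraic complex numbers. A polynomial
  ring over a subfield \<open>F\<close> of it in variables with indices in \<open>V\<close>, and its field of fractions,
  are subsets of the polynomial ring over the complex numbers in the variables
  \<open>\<alpha>\<^sub>0, \<alpha>\<^sub>1, \<dots>\<close> and of the fraction field of that ring.
\<close>

type_synonym cmpoly = "(nat \<Rightarrow>\<^sub>0 nat) \<Rightarrow>\<^sub>0 complex"
type_synonym cratfun = "cmpoly fract"

definition subfield_of_Qbar :: "complex set \<Rightarrow> bool" where
  "subfield_of_Qbar F \<longleftrightarrow>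
     (\<forall>x\<in>F. algebraic x) \<and> 0 \<in> F \<and> 1 \<in> F \<and>
     (\<forall>x\<in>F. \<forall>y\<in>F. x + y \<in> F \<and> x * y \<in> F) \<and>
     (\<forall>x\<in>F. - x \<in> F \<and> inverse x \<in> F)"

definition var :: "nat \<Rightarrow> cmpoly" where
  "var i = Poly_Mapping.single (Poly_Mapping.single i 1) 1"

definition to_rf :: "cmpoly \<Rightarrow> cratfun" where
  "to_rf p = Fract p 1"

definition const_rf :: "complex \<Rightarrow> cratfun" where
  "const_rf z = to_rf (Poly_Mapping.single 0 z)"

definition mpolys :: "complex set \<Rightarrow> nat set \<Rightarrow> cmpoly set" where
  "mpolys F V =
     {p. (\<forall>m. Poly_Mapping.lookup p m \<in> F) \<and>
         (\<forall>m \<in> Poly_Mapping.keys p. Poly_Mapping.keys m \<subseteq> V)}"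

definition ratfuns :: "complex set \<Rightarrow> nat set \<Rightarrow> cratfun set" where
  "ratfuns F V = {Fract p q | p q. p \<in> mpolys F V \<and> q \<in> mpolys F V \<and> q \<noteq> 0}"

text \<open>
  Elements of \<open>F(\<alpha>\<^sub>1,\<dots>,\<alpha>\<^bsub>n-1\<^esub>)[\<alpha>\<^sub>n]\<close> are handled as univariate polynomials with coefficients in
  \<open>F(\<alpha>\<^sub>1,\<dots>,\<alpha>\<^bsub>n-1\<^esub>)\<close>; the element of the rational function field is \<open>poly A (to_rf (var n))\<close>.
  For \<open>n = 1\<close> the index set is empty and \<open>ratfuns F {}\<close> consists of the constants from \<open>F\<close>.
\<close>

definition upolys :: "complex set \<Rightarrow> nat \<Rightarrow> cratfun poly set" where
  "upolys F n = {A. \<forall>i. coeff A i \<in> ratfuns F {1..<n}}"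

definition deg :: "cratfun poly \<Rightarrow> ereal" where
  "deg A = (if A = 0 then -\<infinity> else ereal (real (Polynomial.degree A)))"

definition deg_var :: "nat \<Rightarrow> cmpoly \<Rightarrow> ereal" where
  "deg_var v p =
     (if p = 0 then -\<infinity>
      else ereal (real (Max ((\<lambda>m. Poly_Mapping.lookup m v) ` Poly_Mapping.keys p))))"

text \<open>
  Irreducibility relative to a subring \<open>R\<close>: an irreducible polynomial over \<open>F\<close> may factor over
  the complex numbers, so the type-class predicate \<open>irreducible\<close> does not apply.
\<close>

definition unit_in :: "'a::comm_ring_1 set \<Rightarrow> 'a \<Rightarrow> bool" where
  "unit_in R p \<longleftrightarrow> p \<in> R \<and> (\<exists>q\<in>R. p * q = 1)"

definition irreducible_in :: "'a::comm_ring_1 set \<Rightarrow> 'a \<Rightarrow> bool" where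
  "irreducible_in R p \<longleftrightarrow>
     p \<in> R \<and> p \<noteq> 0 \<and> \<not> unit_in R p \<and>
     (\<forall>a\<in>R. \<forall>b\<in>R. p = a * b \<longrightarrow> unit_in R a \<or> unit_in R b)"

text \<open>
  Outside of \<open>ratfuns F {1..n}\<close> the function \<open>\<sigma>\<close> is arbitrary; on it, the conditions determine
  \<open>\<sigma>\<close> uniquely.
\<close>

definition scaling_automorphism ::
  "complex set \<Rightarrow> nat \<Rightarrow> (nat \<Rightarrow> complex) \<Rightarrow> (cratfun \<Rightarrow> cratfun) \<Rightarrow> bool" where
  "scaling_automorphism F n lam \<sigma> \<longleftrightarrow>
     bij_betw \<sigma> (ratfuns F {1..n}) (ratfuns F {1..n}) \<and>
     (\<forall>x \<in> ratfuns F {1..n}. \<forall>y \<in> ratfuns F {1..n}.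
        \<sigma> (x + y) = \<sigma> x + \<sigma> y \<and> \<sigma> (x * y) = \<sigma> x * \<sigma> y) \<and>
     (\<forall>z\<in>F. \<sigma> (const_rf z) = const_rf z) \<and>
     (\<forall>i\<in>{1..n}. \<sigma> (to_rf (var i)) = const_rf (lam i) * to_rf (var i))"

definition int_iterate :: "'a set \<Rightarrow> ('a \<Rightarrow> 'a) \<Rightarrow> int \<Rightarrow> 'a \<Rightarrow> 'a" where
  "int_iterate L \<sigma> k = (if k \<ge> 0 then \<sigma> ^^ nat k else inv_into L \<sigma> ^^ nat (- k))"

definition Spr ::
  "complex set \<Rightarrow> nat \<Rightarrow> (cratfun \<Rightarrow> cratfun) \<Rightarrow> cmpoly \<Rightarrow> cmpoly \<Rightarrow> int set" where
  "Spr F n \<sigma> p q =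
     {k. \<exists>c' \<in> F - {0}.
        int_iterate (ratfuns F {1..n}) \<sigma> k (to_rf p) = const_rf c' * to_rf q}"

definition sigma_equivalent ::
  "complex set \<Rightarrow> nat \<Rightarrow> (cratfun \<Rightarrow> cratfun) \<Rightarrow> cmpoly \<Rightarrow> cmpoly \<Rightarrow> bool" where
  "sigma_equivalent F n \<sigma> p q \<longleftrightarrow> Spr F n \<sigma> p q \<noteq> {}"

definition csigma_summable ::
  "complex set \<Rightarrow> nat \<Rightarrow> (cratfun \<Rightarrow> cratfun) \<Rightarrow> complex \<Rightarrow> cratfun \<Rightarrow> bool" where
  "csigma_summable F n \<sigma> c f \<longleftrightarrow> (\<exists>g \<in> ratfuns F {1..n}. f = const_rf c * \<sigma> g - g)"

end

theory Submission
  imports Defs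
begin

text \<open>
  Write \<open>x\<close> for \<open>\<alpha>\<^sub>n\<close>, \<open>K\<close> for \<open>F(\<alpha>\<^sub>1,\<dots>,\<alpha>\<^bsub>n-1\<^esub>)\<close> and \<open>P\<close> for \<open>F[\<alpha>\<^sub>1,\<dots>,\<alpha>\<^sub>n]\<close>. If \<open>d\<close> does not involve \<open>x\<close>, the
  degree bounds force \<open>a = b = 0\<close>; so let \<open>d\<close> have positive degree in \<open>x\<close>.

  If \<open>a = \<epsilon> \<sigma>\<^sup>k(b) - b\<close>, then \<open>h = b / d\<^sup>j\<close> satisfies \<open>c\<^sup>k \<sigma>\<^sup>k(h) - h = a / d\<^sup>j\<close>, because \<open>\<sigma>\<^sup>k(d) = u d\<close>, and
  \<open>g = h + c \<sigma>(h) + \<dots> + c\<^bsup>k-1\<^esup> \<sigma>\<^bsup>k-1\<^esup>(h)\<close> satisfies \<open>c \<sigma>(g) - g = a / d\<^sup>j\<close> by telescoping (lemma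
  \<open>telescope\<close>).

  Conversely, let \<open>f = a / d\<^sup>j = c \<sigma>(g) - g\<close>. Summing \<open>c\<^sup>i \<sigma>\<^sup>i(f)\<close> over \<open>i < k\<close> gives \<open>\<tau>(g) - g\<close> with
  \<open>\<tau> = c\<^sup>k \<sigma>\<^sup>k\<close> (lemma \<open>sum_of_iterates\<close>). For \<open>0 < i < k\<close> the irreducible polynomials \<open>\<sigma>\<^sup>i(d)\<close> and \<open>d\<close> are
  not associated, so \<open>\<sigma>\<^sup>i(f)\<close> has no pole at \<open>d\<close> (lemma \<open>iterate_regular\<close>); hence
  \<open>f + r = \<tau>(g) - g\<close> for some \<open>r\<close> without pole at \<open>d\<close>. Only the single prime \<open>d\<close>, which \<open>\<sigma>\<^sup>k\<close> preserves,
  is left. Expand \<open>g\<close> at \<open>d\<close>: its terms \<open>b\<^sub>N / d\<^sup>N\<close> with \<open>deg b\<^sub>N < deg d\<close> are uniquely determined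
  (lemmas \<open>residue\<close> and \<open>small_eval_eq_zero\<close>), and \<open>\<tau>\<close> maps such a term to another one with the same
  denominator. The terms with \<open>N > j\<close> do not contribute to \<open>\<tau>(g) - g\<close> and can be removed, and comparing
  the terms with denominator \<open>d\<^sup>j\<close> yields \<open>a = \<epsilon> \<sigma>\<^sup>k(b\<^sub>j) - b\<^sub>j\<close> (lemma \<open>compare_top_coefficients\<close>).

  The expansion at \<open>d\<close> requires that \<open>d\<close>, irreducible in \<open>P\<close>, is prime in \<open>P\<close> and coprime over \<open>K\<close> to
  every polynomial in \<open>x\<close> that it does not divide. Both are forms of Gauss's lemma. They are proved
  for polynomials over an arbitrary factorial subring of a domain (theorem \<open>factorial_polys_over\<close>
  and lemma \<open>bezout_irreducible\<close>), and reach \<open>P\<close> by induction on the number of variables (lemma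
  \<open>factorial_mpolys\<close>).
\<close>

section \<open>Unique factorization in subrings\<close>

definition dvd_in :: "'a::comm_ring_1 set \<Rightarrow> 'a \<Rightarrow> 'a \<Rightarrow> bool" where
  "dvd_in R a b \<longleftrightarrow> (\<exists>c\<in>R. b = a * c)"

definition polys_over :: "'a::comm_ring_1 set \<Rightarrow> 'a poly set" where
  "polys_over R = {p. \<forall>i. coeff p i \<in> R}"

lemma irreducible_in_factors:
  "irreducible_in R p \<Longrightarrow> a \<in> R \<Longrightarrow> b \<in> R \<Longrightarrow> p = a * b \<Longrightarrow> unit_in R a \<or> unit_in R b"
  unfolding irreducible_in_def by blast

locale subring =
  fixes R :: "'a::comm_ring_1 set"
  assumes zero_closed [simp]: "0 \<in> R"
    and one_closed [simp]: "1 \<in> R"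
    and add_closed [simp]: "a \<in> R \<Longrightarrow> b \<in> R \<Longrightarrow> a + b \<in> R"
    and mult_closed [simp]: "a \<in> R \<Longrightarrow> b \<in> R \<Longrightarrow> a * b \<in> R"
    and uminus_closed [simp]: "a \<in> R \<Longrightarrow> - a \<in> R"
begin

lemma diff_closed [simp]: "a \<in> R \<Longrightarrow> b \<in> R \<Longrightarrow> a - b \<in> R"
  using add_closed[of a "- b"] by simp

lemma power_closed [simp]: "a \<in> R \<Longrightarrow> a ^ m \<in> R"
  by (induction m) auto

lemma sum_closed: "(\<And>i. i \<in> I \<Longrightarrow> h i \<in> R) \<Longrightarrow> sum h I \<in> R"
  by (induction I rule: infinite_finite_induct) auto

lemma subring_polys_over: "subring (polys_over R)"
proof
  fix p q assume "p \<in> polys_over R" "q \<in> polys_over R"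
  then show "p * q \<in> polys_over R"
    by (auto simp: polys_over_def coeff_mult intro!: sum_closed)
qed (auto simp: polys_over_def coeff_1)

lemma smult_polys_over: "a \<in> R \<Longrightarrow> p \<in> polys_over R \<Longrightarrow> smult a p \<in> polys_over R"
  by (auto simp: polys_over_def)

lemma pCons_polys_over: "pCons a p \<in> polys_over R \<longleftrightarrow> a \<in> R \<and> p \<in> polys_over R"
proof
  assume "pCons a p \<in> polys_over R"
  then have "coeff (pCons a p) 0 \<in> R" "\<And>i. coeff (pCons a p) (Suc i) \<in> R"
    unfolding polys_over_def by blast+
  then show "a \<in> R \<and> p \<in> polys_over R"
    by (simp add: polys_over_def)
next
  assume "a \<in> R \<and> p \<in> polys_over R"
  then show "pCons a p \<in> polys_over R"
    by (simp add: polys_over_def coeff_pCons split: nat.split)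
qed

lemma const_polys_over: "[:a:] \<in> polys_over R \<longleftrightarrow> a \<in> R"
  by (auto simp: pCons_polys_over subring.zero_closed[OF subring_polys_over])

lemma monom_polys_over: "a \<in> R \<Longrightarrow> monom a m \<in> polys_over R"
  by (auto simp: polys_over_def)

lemma dvd_in_mult: "dvd_in R a b \<Longrightarrow> c \<in> R \<Longrightarrow> dvd_in R a (c * b)"
  unfolding dvd_in_def using mult_closed mult.left_commute by fast

lemma dvd_in_add: "dvd_in R a b \<Longrightarrow> dvd_in R a c \<Longrightarrow> dvd_in R a (b + c)"
  unfolding dvd_in_def using add_closed by (auto simp flip: distrib_left)

end

lemma unit_in_polys_over:
  fixes R :: "'a::idom set"
  assumes "subring R"
  shows "unit_in (polys_over R) f \<longleftrightarrow> (\<exists>v. unit_in R v \<and> f = [:v:])"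
proof
  assume "unit_in (polys_over R) f"
  then obtain g where fg: "f \<in> polys_over R" "g \<in> polys_over R" "f * g = 1"
    by (auto simp: unit_in_def)
  then have "f \<noteq> 0" "g \<noteq> 0" by auto
  then have "degree f + degree g = 0" using degree_mult_eq[of f g] fg by simp
  then obtain a b where ab: "f = [:a:]" "g = [:b:]"
    by (auto elim!: degree_eq_zeroE)
  with fg have "[:a * b:] = [:1:]" by (simp add: one_pCons mult.commute)
  with fg ab have "a \<in> R" "b \<in> R" "a * b = 1"
    using subring.const_polys_over[OF assms] by auto
  with ab show "\<exists>v. unit_in R v \<and> f = [:v:]"
    by (auto simp: unit_in_def)
next
  assume "\<exists>v. unit_in R v \<and> f = [:v:]"
  then obtain v w where "v \<in> R" "w \<in> R" "v * w = 1" "f = [:v:]"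
    by (auto simp: unit_in_def)
  moreover from this have "[:v:] * [:w:] = 1" by (simp add: one_pCons mult.commute)
  ultimately show "unit_in (polys_over R) f"
    unfolding unit_in_def using subring.const_polys_over[OF assms] by blast
qed

text \<open>
  The field \<open>F\<close> is a set and not a type, so unique factorization is a property of subsets of a fixed
  domain. The number \<open>\<Omega>\<close> of irreducible factors, counted with multiplicity, stands for the existence
  of factorizations. For a polynomial, the degree plus \<open>\<Omega>\<close> of the leading coefficient is again
  additive and again zero exactly on units; this is what makes the passage to polynomials short.
\<close>

locale factorial_subring = subring R for R :: "'a::idom set" +
  assumes length_function: "\<exists>\<Omega>::'a \<Rightarrow> nat.
      (\<forall>a\<in>R - {0}. \<forall>b\<in>R - {0}. \<Omega> (a * b) = \<Omega> a + \<Omega> b) \<and>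
      (\<forall>a\<in>R - {0}. \<Omega> a = 0 \<longleftrightarrow> unit_in R a)"
    and irreducible_imp_prime:
      "irreducible_in R p \<Longrightarrow> a \<in> R \<Longrightarrow> b \<in> R \<Longrightarrow> dvd_in R p (a * b) \<Longrightarrow>
         dvd_in R p a \<or> dvd_in R p b"
begin

lemma length_functionE:
  obtains \<Omega> :: "'a \<Rightarrow> nat" where
    "\<And>a b. a \<in> R \<Longrightarrow> a \<noteq> 0 \<Longrightarrow> b \<in> R \<Longrightarrow> b \<noteq> 0 \<Longrightarrow> \<Omega> (a * b) = \<Omega> a + \<Omega> b"
    "\<And>a. a \<in> R \<Longrightarrow> a \<noteq> 0 \<Longrightarrow> \<Omega> a = 0 \<longleftrightarrow> unit_in R a"
proof -
  obtain \<Omega> :: "'a \<Rightarrow> nat" where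
    "(\<forall>a\<in>R - {0}. \<forall>b\<in>R - {0}. \<Omega> (a * b) = \<Omega> a + \<Omega> b) \<and>
     (\<forall>a\<in>R - {0}. \<Omega> a = 0 \<longleftrightarrow> unit_in R a)"
    using length_function by (rule exE)
  then show ?thesis by (intro that[of \<Omega>]) auto
qed

lemma irreducible_factor:
  assumes "r \<in> R" "r \<noteq> 0" "\<not> unit_in R r"
  shows "\<exists>p r'. irreducible_in R p \<and> r' \<in> R \<and> r = p * r'"
proof -
  obtain \<Omega> :: "'a \<Rightarrow> nat" where
    add: "\<And>a b. a \<in> R \<Longrightarrow> a \<noteq> 0 \<Longrightarrow> b \<in> R \<Longrightarrow> b \<noteq> 0 \<Longrightarrow> \<Omega> (a * b) = \<Omega> a + \<Omega> b" and
    unit: "\<And>a. a \<in> R \<Longrightarrow> a \<noteq> 0 \<Longrightarrow> \<Omega> a = 0 \<longleftrightarrow> unit_in R a"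
    by (rule length_functionE, rule that)
  show ?thesis
    using assms
  proof (induction "\<Omega> r" arbitrary: r rule: less_induct)
    case less
    show ?case
    proof (cases "irreducible_in R r")
      case True
      then show ?thesis using one_closed by (intro exI[of _ r] exI[of _ 1]) simp
    next
      case False
      with less.prems obtain a b where ab: "a \<in> R" "b \<in> R" "r = a * b" "\<not> unit_in R a" "\<not> unit_in R b"
        unfolding irreducible_in_def by blast
      with less.prems have nz: "a \<noteq> 0" "b \<noteq> 0" by auto
      with ab have "\<Omega> a < \<Omega> r"
        using add[of a b] unit[of b] by auto
      from less.hyps[OF this ab(1) nz(1) ab(4)] obtain p r'
        where "irreducible_in R p" "r' \<in> R" "a = p * r'" by blast
      with ab show ?thesis by (intro exI[of _ p] exI[of _ "r' * b"]) (simp add: mult.assoc)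
    qed
  qed
qed

text \<open>
  Existence of factorizations, in the form in which it is used: any statement about a nonzero
  element can be proved by removing one irreducible factor at a time.
\<close>

lemma prime_factor_induct [consumes 2, case_names unit irreducible]:
  assumes "r \<in> R" "r \<noteq> 0"
    and unit_case: "\<And>r. unit_in R r \<Longrightarrow> Q r"
    and step: "\<And>p r. irreducible_in R p \<Longrightarrow> r \<in> R \<Longrightarrow> r \<noteq> 0 \<Longrightarrow> Q r \<Longrightarrow> Q (p * r)"
  shows "Q r"
proof -
  obtain \<Omega> :: "'a \<Rightarrow> nat" where
    add: "\<And>a b. a \<in> R \<Longrightarrow> a \<noteq> 0 \<Longrightarrow> b \<in> R \<Longrightarrow> b \<noteq> 0 \<Longrightarrow> \<Omega> (a * b) = \<Omega> a + \<Omega> b" and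
    unit: "\<And>a. a \<in> R \<Longrightarrow> a \<noteq> 0 \<Longrightarrow> \<Omega> a = 0 \<longleftrightarrow> unit_in R a"
    by (rule length_functionE, rule that)
  show ?thesis
    using assms(1,2)
  proof (induction "\<Omega> r" arbitrary: r rule: less_induct)
    case less
    show ?case
    proof (cases "unit_in R r")
      case False
      from irreducible_factor[OF less.prems False] obtain p r'
        where p: "irreducible_in R p" and r': "r' \<in> R" "r = p * r'" by blast
      then have "p \<in> R" "p \<noteq> 0" "\<not> unit_in R p" "r' \<noteq> 0"
        using less.prems by (auto simp: irreducible_in_def)
      then have "\<Omega> r' < \<Omega> r"
        using add[of p r'] unit[of p] r' by auto
      from less.hyps[OF this r'(1) \<open>r' \<noteq> 0\<close>] have "Q r'" .
      with step[OF p r'(1) \<open>r' \<noteq> 0\<close>] r'(2) show ?thesis by simp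
    qed (use unit_case in blast)
  qed
qed

text \<open>
  Gauss's lemma. If \<open>p\<close> divides \<open>f g\<close>, it divides the product of the leading coefficients, hence one of
  them, say that of \<open>f\<close>. Then \<open>p\<close> still divides the product of \<open>g\<close> and of \<open>f\<close> without its leading
  term, which has smaller degree.
\<close>

lemma irreducible_const_prime:
  assumes p: "irreducible_in R p" and "f \<in> polys_over R" "g \<in> polys_over R"
    and "\<And>i. dvd_in R p (coeff (f * g) i)"
  shows "(\<forall>i. dvd_in R p (coeff f i)) \<or> (\<forall>i. dvd_in R p (coeff g i))"
  using assms(2-)
proof (induction "degree f + degree g" arbitrary: f g rule: less_induct)
  case less
  interpret S: subring "polys_over R" by (rule subring_polys_over)
  have zero: "dvd_in R p 0" by (auto simp: dvd_in_def intro!: bexI[of _ 0])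
  have reduce: "(\<forall>i. dvd_in R p (coeff f i)) \<or> (\<forall>i. dvd_in R p (coeff g i))"
    if f: "f \<in> polys_over R" and g: "g \<in> polys_over R"
      and fg: "\<And>i. dvd_in R p (coeff (f * g) i)"
      and lc: "dvd_in R p (lead_coeff f)"
      and IH: "\<And>f'. f' \<in> polys_over R \<Longrightarrow> degree f' < degree f \<Longrightarrow>
                (\<And>i. dvd_in R p (coeff (f' * g) i)) \<Longrightarrow>
                (\<forall>i. dvd_in R p (coeff f' i)) \<or> (\<forall>i. dvd_in R p (coeff g i))"
    for f g
  proof (cases "degree f = 0")
    case True
    then have "dvd_in R p (coeff f i)" for i
      using lc zero by (cases "i = 0") (auto simp: coeff_eq_0)
    then show ?thesis by blast
  next
    case False
    let ?m = "monom (lead_coeff f) (degree f)"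
    have lcR: "lead_coeff f \<in> R" using f by (auto simp: polys_over_def)
    have "degree (f - ?m) < degree f"
      using False
      by (intro degree_lessI) (auto simp: coeff_eq_0)
    moreover have "f - ?m \<in> polys_over R"
      using f lcR monom_polys_over by auto
    moreover have "dvd_in R p (coeff ((f - ?m) * g) i)" for i
    proof -
      have "coeff ((f - ?m) * g) i =
          coeff (f * g) i + (- (if degree f \<le> i then coeff g (i - degree f) else 0)) * lead_coeff f"
        by (auto simp: left_diff_distrib coeff_monom_mult)
      moreover have "- (if degree f \<le> i then coeff g (i - degree f) else 0) \<in> R"
        using g by (auto simp: polys_over_def)
      ultimately show ?thesis
        using fg lc dvd_in_add dvd_in_mult by metis
    qed
    ultimately have "(\<forall>i. dvd_in R p (coeff (f - ?m) i)) \<or> (\<forall>i. dvd_in R p (coeff g i))"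
      using IH by blast
    moreover have "dvd_in R p (coeff f i)" if "\<forall>i. dvd_in R p (coeff (f - ?m) i)" for i
    proof (cases "i = degree f")
      case False
      then show ?thesis using that[rule_format, of i] by simp
    qed (use lc in simp)
    ultimately show ?thesis by blast
  qed
  have "dvd_in R p (lead_coeff f * lead_coeff g)"
    using less.prems(3)[of "degree f + degree g"] by (simp add: coeff_mult_degree_sum)
  then have "dvd_in R p (lead_coeff f) \<or> dvd_in R p (lead_coeff g)"
    using irreducible_imp_prime[OF p] less.prems(1,2) by (auto simp: polys_over_def)
  then show ?case
  proof
    assume "dvd_in R p (lead_coeff f)"
    then show ?thesis
      using reduce[of f g] less by auto
  next
    assume "dvd_in R p (lead_coeff g)"
    moreover have "(\<forall>i. dvd_in R p (coeff g' i)) \<or> (\<forall>i. dvd_in R p (coeff f i))"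
      if "g' \<in> polys_over R" "degree g' < degree g" "\<And>i. dvd_in R p (coeff (g' * f) i)" for g'
      using less.hyps[of f g'] less.prems that by (auto simp: mult.commute)
    ultimately show ?thesis
      using reduce[of g f] less.prems by (auto simp: mult.commute)
  qed
qed

lemma const_dvd_in_polys_over:
  assumes "\<And>i. dvd_in R p (coeff f i)"
  shows "\<exists>f'\<in>polys_over R. f = smult p f'"
proof -
  from assms obtain h where h: "\<And>i. h i \<in> R" "\<And>i. coeff f i = p * h i"
    unfolding dvd_in_def by metis
  let ?g = "poly_of_list (map h [0..<Suc (degree f)])"
  have cg: "coeff ?g i = (if i \<le> degree f then h i else 0)" for i
    by (auto simp: poly_of_list_def nth_default_def simp del: upt_Suc)
  have "f = smult p ?g"
    by (rule poly_eqI) (auto simp: cg h(2)[symmetric] coeff_eq_0 simp del: poly_of_list_def upt_Suc)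
  moreover have "?g \<in> polys_over R"
    by (auto simp: polys_over_def cg h(1) simp del: poly_of_list_def upt_Suc)
  ultimately show ?thesis by blast
qed

text \<open>
  Each irreducible factor of \<open>r\<close> divides \<open>m q\<close>, hence \<open>m\<close> or \<open>q\<close>, and can be cancelled there. In this
  way a factorization of \<open>r f\<close> yields one of \<open>f\<close>.
\<close>

lemma split_constant_factor:
  assumes "r \<in> R" "r \<noteq> 0" "f \<in> polys_over R" "m \<in> polys_over R" "q \<in> polys_over R"
    and "smult r f = m * q"
  shows "\<exists>m'\<in>polys_over R. \<exists>q'\<in>polys_over R. \<exists>s\<in>R. \<exists>t\<in>R.
           f = m' * q' \<and> m = smult s m' \<and> q = smult t q'"
  using assms
proof (induction r arbitrary: m q rule: prime_factor_induct)
  case (unit r)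
  then obtain v where v: "r \<in> R" "v \<in> R" "r * v = 1" by (auto simp: unit_in_def)
  then have "f = m * smult v q"
    using unit.prems by (metis mult.commute mult_smult_right smult_1_left smult_smult)
  moreover have "q = smult r (smult v q)" using v by simp
  ultimately show ?case
    using unit.prems(2,3) v smult_polys_over
    by (intro bexI[of _ m] bexI[of _ "smult v q"] bexI[of _ 1] bexI[of _ r]) auto
next
  case (irreducible p r)
  then have pR: "p \<in> R" "p \<noteq> 0" by (auto simp: irreducible_in_def)
  have "dvd_in R p (coeff (m * q) i)" for i
  proof -
    have "coeff (m * q) i = p * (r * coeff f i)"
      using irreducible.prems(4) by (metis coeff_smult mult.assoc)
    moreover have "r * coeff f i \<in> R"
      using irreducible by (auto simp: polys_over_def)
    ultimately show ?thesis by (auto simp: dvd_in_def)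
  qed
  then consider m1 where "m1 \<in> polys_over R" "m = smult p m1"
    | q1 where "q1 \<in> polys_over R" "q = smult p q1"
    using irreducible_const_prime[OF irreducible.hyps(1) irreducible.prems(2,3)]
      const_dvd_in_polys_over by blast
  then show ?case
  proof cases
    case 1
    then have "smult p (smult r f) = smult p (m1 * q)"
      using irreducible.prems by simp
    then have "smult r f = m1 * q" using pR by (metis smult_cancel)
    from irreducible.IH[OF irreducible.prems(1) 1(1) irreducible.prems(3) this] obtain m' q' s t
      where *: "m' \<in> polys_over R" "q' \<in> polys_over R" "s \<in> R" "t \<in> R"
        "f = m' * q'" "m1 = smult s m'" "q = smult t q'" by (elim bexE conjE) (rule that)
    then have "m = smult (p * s) m'" using 1 by simp
    with * show ?thesis using mult_closed[OF pR(1)] by blast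
  next
    case 2
    then have "smult p (smult r f) = smult p (m * q1)"
      using irreducible.prems by simp
    then have "smult r f = m * q1" using pR by (metis smult_cancel)
    from irreducible.IH[OF irreducible.prems(1,2) 2(1) this] obtain m' q' s t
      where *: "m' \<in> polys_over R" "q' \<in> polys_over R" "s \<in> R" "t \<in> R"
        "f = m' * q'" "m = smult s m'" "q1 = smult t q'" by (elim bexE conjE) (rule that)
    then have "q = smult (p * t) q'" using 2 by simp
    with * show ?thesis using mult_closed[OF pR(1)] by blast
  qed
qed

text \<open>
  An irreducible polynomial of positive degree has no nonunit constant factor, so constants on the
  other side of a divisibility do not matter.
\<close>

lemma irreducible_dvd_smult:
  assumes f: "irreducible_in (polys_over R) f" "degree f > 0"
    and g: "g \<in> polys_over R" and r: "r \<in> R" "r \<noteq> 0"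
    and "dvd_in (polys_over R) f (smult r g)"
  shows "dvd_in (polys_over R) f g"
proof -
  have fR: "f \<in> polys_over R" using f by (simp add: irreducible_in_def)
  obtain w where "w \<in> polys_over R" "smult r g = f * w"
    using assms(6) by (auto simp: dvd_in_def)
  from split_constant_factor[OF r g fR this]
  obtain f' w' s t where *: "f' \<in> polys_over R" "w' \<in> polys_over R" "s \<in> R" "t \<in> R"
        "g = f' * w'" "f = smult s f'" by (elim bexE conjE) (rule that)
  from *(6) have "f = [:s:] * f'" by simp
  then have "unit_in (polys_over R) [:s:] \<or> unit_in (polys_over R) f'"
    using irreducible_in_factors[OF f(1)] *(1,3) const_polys_over by blast
  moreover have "\<not> unit_in (polys_over R) f'"
    using f(2) *(6) unfolding unit_in_polys_over[OF subring_axioms] by (auto split: if_splits)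
  ultimately have "unit_in R s"
    unfolding unit_in_polys_over[OF subring_axioms] by auto
  then obtain v where v: "v \<in> R" "s * v = 1"
    by (auto simp: unit_in_def)
  then have "f * smult v w' = g" using *(5,6) by (simp add: mult.commute)
  moreover have "smult v w' \<in> polys_over R" using v * smult_polys_over by blast
  ultimately show ?thesis unfolding dvd_in_def by metis
qed

end

context subring
begin

text \<open>
  Long division inside \<open>R[X]\<close>: every step costs one factor \<open>lead_coeff m\<close> instead of a division by it.
\<close>

lemma pseudo_division:
  assumes "m \<in> polys_over R" "m \<noteq> 0" "f \<in> polys_over R"
  shows "\<exists>e. \<exists>q\<in>polys_over R. \<exists>t\<in>polys_over R.
           smult (lead_coeff m ^ e) f = q * m + t \<and> (t = 0 \<or> degree t < degree m)"
  using assms(3)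
proof (induction "degree f" arbitrary: f rule: less_induct)
  case less
  interpret S: subring "polys_over R" by (rule subring_polys_over)
  show ?case
  proof (cases "f = 0 \<or> degree f < degree m")
    case True
    then have "smult (lead_coeff m ^ 0) f = 0 * m + f \<and> (f = 0 \<or> degree f < degree m)" by simp
    with less.prems show ?thesis using S.zero_closed by blast
  next
    case False
    have lc: "lead_coeff m \<in> R" "lead_coeff f \<in> R" using assms less.prems by (auto simp: polys_over_def)
    let ?s = "monom (lead_coeff f) (degree f - degree m)"
    let ?f' = "smult (lead_coeff m) f - ?s * m"
    have s: "?s \<in> polys_over R" using lc monom_polys_over by blast
    have f': "?f' \<in> polys_over R" by (intro S.diff_closed S.mult_closed smult_polys_over s less.prems assms lc)
    have step: "smult (lead_coeff m) f = ?s * m + ?f'" by simp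
    have top: "coeff ?f' i = 0" if "i \<ge> degree f" for i
    proof -
      have "coeff (?s * m) i = lead_coeff f * coeff m (i - (degree f - degree m))"
        using that by (simp add: coeff_monom_mult)
      with that False show ?thesis
        by (cases "i = degree f") (auto simp: coeff_eq_0)
    qed
    show ?thesis
    proof (cases "degree f = 0")
      case True
      then have "?f' = 0" using top by (intro poly_eqI) auto
      then have "smult (lead_coeff m ^ 1) f = ?s * m + 0 \<and> (0 = 0 \<or> degree 0 < degree m)"
        using step by simp
      with s show ?thesis using S.zero_closed by blast
    next
      case False
      then have "degree ?f' < degree f" using top by (intro degree_lessI) auto
      from less.hyps[OF this f'] obtain e q t where *: "q \<in> polys_over R" "t \<in> polys_over R"
        "smult (lead_coeff m ^ e) ?f' = q * m + t" "t = 0 \<or> degree t < degree m" by blast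
      have "smult (lead_coeff m ^ Suc e) f = smult (lead_coeff m ^ e) (smult (lead_coeff m) f)"
        by (simp add: mult.commute)
      also have "\<dots> = (smult (lead_coeff m ^ e) ?s + q) * m + t"
        by (subst step, subst smult_add_right, subst *(3)) (simp add: distrib_right)
      finally have "smult (lead_coeff m ^ Suc e) f = (smult (lead_coeff m ^ e) ?s + q) * m + t" .
      moreover have "smult (lead_coeff m ^ e) ?s + q \<in> polys_over R"
        by (intro S.add_closed smult_polys_over power_closed * s lc)
      ultimately show ?thesis using *(2,4) by blast
    qed
  qed
qed

end

context factorial_subring
begin

text \<open>
  Over the fraction field of \<open>R\<close> the polynomials \<open>f\<close> and \<open>g\<close> are coprime; \<open>s\<close> is a common denominator of
  a Bezout relation. The proof takes a combination \<open>m\<close> of \<open>f\<close> and \<open>g\<close> of minimal degree. By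
  pseudo-division it divides \<open>f\<close> and \<open>g\<close> up to constants, so irreducibility of \<open>f\<close> makes \<open>m\<close> either a
  constant or a constant multiple of \<open>f\<close>; the second would force \<open>f\<close> to divide \<open>g\<close>.
\<close>

lemma bezout_irreducible:
  assumes f: "irreducible_in (polys_over R) f" "degree f > 0"
    and g: "g \<in> polys_over R" "\<not> dvd_in (polys_over R) f g"
  shows "\<exists>a\<in>polys_over R. \<exists>b\<in>polys_over R. \<exists>s\<in>R. s \<noteq> 0 \<and> [:s:] = a * f + b * g"
proof -
  interpret S: subring "polys_over R" by (rule subring_polys_over)
  have fR: "f \<in> polys_over R" using f by (simp add: irreducible_in_def)
  let ?I = "\<lambda>m. \<exists>a\<in>polys_over R. \<exists>b\<in>polys_over R. m = a * f + b * g"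
  have "?I f" by (intro bexI[of _ 1] bexI[of _ 0]) auto
  moreover have "f \<noteq> 0" using f by auto
  ultimately obtain m where m: "?I m" "m \<noteq> 0"
    and min: "\<And>m'. ?I m' \<Longrightarrow> m' \<noteq> 0 \<Longrightarrow> degree m \<le> degree m'"
    using ex_has_least_nat[of "\<lambda>m. ?I m \<and> m \<noteq> 0" f degree] by blast
  then obtain a b where ab: "a \<in> polys_over R" "b \<in> polys_over R" "m = a * f + b * g" by blast
  have mR: "m \<in> polys_over R" using ab fR g by auto
  have lc: "lead_coeff m ^ e \<in> R" "lead_coeff m ^ e \<noteq> 0" for e
    using mR m(2) power_closed by (auto simp: polys_over_def)
  have m_dvd: "\<exists>e. \<exists>q\<in>polys_over R. smult (lead_coeff m ^ e) h = q * m" if "?I h" for h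
  proof -
    from that obtain a' b' where h: "a' \<in> polys_over R" "b' \<in> polys_over R" "h = a' * f + b' * g"
      by blast
    then have "h \<in> polys_over R" using fR g by auto
    from pseudo_division[OF mR m(2) this] obtain e q t where
      qt: "q \<in> polys_over R" "t \<in> polys_over R" "smult (lead_coeff m ^ e) h = q * m + t"
      "t = 0 \<or> degree t < degree m" by blast
    have "t = smult (lead_coeff m ^ e) h - q * m" using qt by simp
    also have "\<dots> = (smult (lead_coeff m ^ e) a' - q * a) * f + (smult (lead_coeff m ^ e) b' - q * b) * g"
      unfolding h ab(3) by (simp add: algebra_simps smult_add_right)
    finally have "t = (smult (lead_coeff m ^ e) a' - q * a) * f + (smult (lead_coeff m ^ e) b' - q * b) * g" .
    moreover have "smult (lead_coeff m ^ e) a' - q * a \<in> polys_over R"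
      "smult (lead_coeff m ^ e) b' - q * b \<in> polys_over R"
      using h ab qt lc smult_polys_over by auto
    ultimately have "?I t" by blast
    with min qt have "t = 0" by (meson not_less)
    with qt show ?thesis by auto
  qed
  obtain e q where q: "q \<in> polys_over R" "smult (lead_coeff m ^ e) f = q * m"
    using m_dvd[OF \<open>?I f\<close>] by blast
  from split_constant_factor[OF lc fR q(1) mR q(2)]
  obtain q' m' s where s: "q' \<in> polys_over R" "m' \<in> polys_over R" "s \<in> R" "f = q' * m'" "m = smult s m'"
    by (elim bexE conjE) (rule that)
  then have "unit_in (polys_over R) q' \<or> unit_in (polys_over R) m'"
    using irreducible_in_factors[OF f(1)] by blast
  then show ?thesis
  proof
    assume "unit_in (polys_over R) m'"
    then obtain v where v: "unit_in R v" "m' = [:v:]"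
      using unit_in_polys_over[OF subring_axioms] by blast
    then have "m = [:s * v:]" "s * v \<in> R" "s * v \<noteq> 0" using s m by (auto simp: unit_in_def)
    with ab show ?thesis by metis
  next
    assume "unit_in (polys_over R) q'"
    then obtain v where v: "v \<in> polys_over R" "q' * v = 1" by (auto simp: unit_in_def)
    have "f * v = m' * (q' * v)" using s(4) by (simp only: ac_simps)
    then have m': "m' = f * v" using v(2) by simp
    have "?I g" by (intro bexI[of _ 0] bexI[of _ 1]) auto
    from m_dvd[OF this] obtain e q2 where q2: "q2 \<in> polys_over R" "smult (lead_coeff m ^ e) g = q2 * m"
      by blast
    have "m = smult s (f * v)" using s(5) unfolding m' .
    then have "q2 * m = f * (v * smult s q2)"
      by (simp add: mult.left_commute mult.commute)
    with q2(2) have "smult (lead_coeff m ^ e) g = f * (v * smult s q2)" by (rule trans)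
    then have "dvd_in (polys_over R) f (smult (lead_coeff m ^ e) g)"
      using S.mult_closed[OF v(1) smult_polys_over[OF s(3) q2(1)]] unfolding dvd_in_def by blast
    then have "dvd_in (polys_over R) f g" using irreducible_dvd_smult[OF f g(1)] lc by blast
    with g show ?thesis by blast
  qed
qed

lemma irreducible_const:
  assumes "irreducible_in (polys_over R) [:p:]"
  shows "irreducible_in R p"
proof -
  have unit: "unit_in (polys_over R) [:a:] \<longleftrightarrow> unit_in R a" for a
    using unit_in_polys_over[OF subring_axioms] by auto
  have "unit_in R a \<or> unit_in R b" if "a \<in> R" "b \<in> R" "p = a * b" for a b
  proof -
    from that have "[:p:] = [:a:] * [:b:]" by simp
    with assms that(1,2) show ?thesis
      unfolding irreducible_in_def unit[symmetric] using const_polys_over by blast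
  qed
  with assms show ?thesis
    unfolding irreducible_in_def by (auto simp: unit const_polys_over)
qed

text \<open>
  A constant irreducible is prime by Gauss's lemma. For an irreducible \<open>f\<close> of positive degree that
  divides \<open>g h\<close> but not \<open>g\<close>, multiply a relation \<open>s = a f + b g\<close> by \<open>h\<close>: \<open>f\<close> divides \<open>s h\<close>, hence \<open>h\<close>.
\<close>

theorem factorial_polys_over: "factorial_subring (polys_over R)"
proof -
  interpret S: subring "polys_over R" by (rule subring_polys_over)
  show ?thesis
  proof (intro factorial_subring.intro factorial_subring_axioms.intro subring_polys_over)
    obtain \<Omega> :: "'a \<Rightarrow> nat" where
      add: "\<And>a b. a \<in> R \<Longrightarrow> a \<noteq> 0 \<Longrightarrow> b \<in> R \<Longrightarrow> b \<noteq> 0 \<Longrightarrow> \<Omega> (a * b) = \<Omega> a + \<Omega> b" and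
      unit: "\<And>a. a \<in> R \<Longrightarrow> a \<noteq> 0 \<Longrightarrow> \<Omega> a = 0 \<longleftrightarrow> unit_in R a"
      by (rule length_functionE, rule that)
    let ?\<Omega> = "\<lambda>f. degree f + \<Omega> (lead_coeff f)"
    have lc: "lead_coeff f \<in> R" if "f \<in> polys_over R" for f using that by (auto simp: polys_over_def)
    have mult': "?\<Omega> (f * g) = ?\<Omega> f + ?\<Omega> g" if "f \<in> polys_over R - {0}" "g \<in> polys_over R - {0}" for f g
      using that lc add by (auto simp: coeff_mult_degree_sum degree_mult_eq)
    have unit': "?\<Omega> f = 0 \<longleftrightarrow> unit_in (polys_over R) f" if "f \<in> polys_over R - {0}" for f
    proof -
      have "?\<Omega> f = 0 \<longleftrightarrow> degree f = 0 \<and> unit_in R (lead_coeff f)"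
        using that lc[of f] unit[of "lead_coeff f"] by auto
      also have "\<dots> \<longleftrightarrow> unit_in (polys_over R) f"
        unfolding unit_in_polys_over[OF subring_axioms] by (auto elim!: degree_eq_zeroE)
      finally show ?thesis .
    qed
    show "\<exists>\<Omega>::'a poly \<Rightarrow> nat.
      (\<forall>a\<in>polys_over R - {0}. \<forall>b\<in>polys_over R - {0}. \<Omega> (a * b) = \<Omega> a + \<Omega> b) \<and>
      (\<forall>a\<in>polys_over R - {0}. \<Omega> a = 0 \<longleftrightarrow> unit_in (polys_over R) a)"
      by (intro exI[of _ ?\<Omega>] conjI ballI mult' unit')
  next
    fix f g h
    assume f: "irreducible_in (polys_over R) f" and gh: "g \<in> polys_over R" "h \<in> polys_over R"
      and dvd: "dvd_in (polys_over R) f (g * h)"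
    have fR: "f \<in> polys_over R" using f by (simp add: irreducible_in_def)
    show "dvd_in (polys_over R) f g \<or> dvd_in (polys_over R) f h"
    proof (cases "degree f = 0")
      case True
      then obtain p where p: "f = [:p:]" by (auto elim: degree_eq_zeroE)
      then have irr: "irreducible_in R p" using f irreducible_const by blast
      have "dvd_in R p (coeff (g * h) i)" for i
        using dvd unfolding dvd_in_def p by (auto simp: polys_over_def intro!: bexI)
      from irreducible_const_prime[OF irr gh this] show ?thesis
        using const_dvd_in_polys_over[of p g] const_dvd_in_polys_over[of p h]
        unfolding p by (auto simp: dvd_in_def[of "polys_over R"])
    next
      case False
      show ?thesis
      proof (cases "dvd_in (polys_over R) f g")
        case False
        with bezout_irreducible[OF f _ gh(1)] \<open>degree f \<noteq> 0\<close> obtain a b s where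
          *: "a \<in> polys_over R" "b \<in> polys_over R" "s \<in> R" "s \<noteq> 0" "[:s:] = a * f + b * g" by auto
        have "smult s h = [:s:] * h" by simp
        also have "\<dots> = a * h * f + b * (g * h)" unfolding * by (simp add: algebra_simps)
        finally have "smult s h = a * h * f + b * (g * h)" .
        moreover have "dvd_in (polys_over R) f (a * h * f)"
          using * gh by (auto simp: dvd_in_def ac_simps)
        ultimately have "dvd_in (polys_over R) f (smult s h)"
          using S.dvd_in_add[OF _ S.dvd_in_mult[OF dvd *(2)]] by simp
        then show ?thesis using irreducible_dvd_smult[OF f _ gh(2) *(3,4)] \<open>degree f \<noteq> 0\<close> by simp
      qed blast
    qed
  qed
qed

end

section \<open>Isomorphic images and fractions\<close>

locale subring_embedding = subring R for R :: "'a::idom set" +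
  fixes \<phi> :: "'a \<Rightarrow> 'b::idom"
  assumes hom_one: "\<phi> 1 = 1"
    and hom_add: "\<phi> (a + b) = \<phi> a + \<phi> b"
    and hom_mult: "\<phi> (a * b) = \<phi> a * \<phi> b"
    and kernel: "a \<in> R \<Longrightarrow> \<phi> a = 0 \<Longrightarrow> a = 0"
begin

lemma hom_zero: "\<phi> 0 = 0"
  using hom_add[of 0 0] by (metis add.right_neutral add_left_cancel)

lemma hom_uminus: "\<phi> (- a) = - \<phi> a"
  using hom_add[of a "- a"] hom_zero by (simp add: eq_neg_iff_add_eq_0 add.commute)

lemma hom_diff: "\<phi> (a - b) = \<phi> a - \<phi> b"
  using hom_add[of a "- b"] hom_uminus by simp

lemma hom_eq_iff: "a \<in> R \<Longrightarrow> b \<in> R \<Longrightarrow> \<phi> a = \<phi> b \<longleftrightarrow> a = b"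
  using kernel[of "a - b"] hom_diff[of a b] by auto

lemma hom_eq_zero_iff: "a \<in> R \<Longrightarrow> \<phi> a = 0 \<longleftrightarrow> a = 0"
  using kernel hom_zero by auto

lemma subring_image: "subring (\<phi> ` R)"
proof
  show "0 \<in> \<phi> ` R" using hom_zero by (intro image_eqI[of _ _ 0]) auto
  show "1 \<in> \<phi> ` R" using hom_one by (intro image_eqI[of _ _ 1]) auto
next
  fix y z assume "y \<in> \<phi> ` R" "z \<in> \<phi> ` R"
  then obtain a b where ab: "a \<in> R" "b \<in> R" "y = \<phi> a" "z = \<phi> b" by blast
  then show "y + z \<in> \<phi> ` R" "y * z \<in> \<phi> ` R"
    by (simp_all flip: hom_add hom_mult)
next
  fix y assume "y \<in> \<phi> ` R"
  then obtain a where "a \<in> R" "y = \<phi> a" by blast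
  then show "- y \<in> \<phi> ` R" by (simp flip: hom_uminus)
qed

lemma dvd_in_image: "a \<in> R \<Longrightarrow> b \<in> R \<Longrightarrow> dvd_in (\<phi> ` R) (\<phi> a) (\<phi> b) \<longleftrightarrow> dvd_in R a b"
  by (auto simp: dvd_in_def hom_eq_iff simp flip: hom_mult)

lemma unit_in_image: "a \<in> R \<Longrightarrow> unit_in (\<phi> ` R) (\<phi> a) \<longleftrightarrow> unit_in R a"
  using hom_eq_iff[OF mult_closed one_closed] by (auto simp: unit_in_def hom_one simp flip: hom_mult)

lemma irreducible_in_image:
  assumes "p \<in> R"
  shows "irreducible_in (\<phi> ` R) (\<phi> p) \<longleftrightarrow> irreducible_in R p"
  using assms
  by (auto simp: irreducible_in_def hom_eq_zero_iff unit_in_image hom_eq_iff simp flip: hom_mult)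

end

text \<open>
  Unique factorization is invariant under isomorphism. It is moved from coefficient polynomials to
  the ring that they generate in the field of rational functions.
\<close>

lemma factorial_image:
  fixes \<phi> :: "'a::idom \<Rightarrow> 'b::idom"
  assumes "factorial_subring R" "subring_embedding R \<phi>"
  shows "factorial_subring (\<phi> ` R)"
proof -
  interpret factorial_subring R by fact
  interpret subring_embedding R \<phi> by fact
  show ?thesis
  proof (intro factorial_subring.intro factorial_subring_axioms.intro subring_image)
    obtain \<Omega> :: "'a \<Rightarrow> nat" where
      add: "\<And>a b. a \<in> R \<Longrightarrow> a \<noteq> 0 \<Longrightarrow> b \<in> R \<Longrightarrow> b \<noteq> 0 \<Longrightarrow> \<Omega> (a * b) = \<Omega> a + \<Omega> b" and
      unit: "\<And>a. a \<in> R \<Longrightarrow> a \<noteq> 0 \<Longrightarrow> \<Omega> a = 0 \<longleftrightarrow> unit_in R a"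
      by (rule length_functionE, rule that)
    define \<psi> where "\<psi> = inv_into R \<phi>"
    have "inj_on \<phi> R" by (intro inj_onI) (simp add: hom_eq_iff)
    then have psi: "\<psi> (\<phi> a) = a" if "a \<in> R" for a
      using that by (simp add: \<psi>_def)
    have mult': "\<Omega> (\<psi> (y * z)) = \<Omega> (\<psi> y) + \<Omega> (\<psi> z)"
      if yz: "y \<in> \<phi> ` R - {0}" "z \<in> \<phi> ` R - {0}" for y z
    proof -
      from yz obtain a b where "a \<in> R" "b \<in> R" "y = \<phi> a" "z = \<phi> b" by blast
      with yz show ?thesis
        using add[of a b] by (auto simp: hom_eq_zero_iff psi simp flip: hom_mult)
    qed
    have unit': "\<Omega> (\<psi> y) = 0 \<longleftrightarrow> unit_in (\<phi> ` R) y" if y: "y \<in> \<phi> ` R - {0}" for y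
    proof -
      from y obtain a where "a \<in> R" "y = \<phi> a" by blast
      with y show ?thesis using unit[of a] by (auto simp: hom_eq_zero_iff psi unit_in_image)
    qed
    show "\<exists>\<Omega>::'b \<Rightarrow> nat.
      (\<forall>a\<in>\<phi> ` R - {0}. \<forall>b\<in>\<phi> ` R - {0}. \<Omega> (a * b) = \<Omega> a + \<Omega> b) \<and>
      (\<forall>a\<in>\<phi> ` R - {0}. \<Omega> a = 0 \<longleftrightarrow> unit_in (\<phi> ` R) a)"
      by (intro exI[of _ "\<lambda>y. \<Omega> (\<psi> y)"] conjI ballI mult' unit')
  next
    fix y v w assume y: "irreducible_in (\<phi> ` R) y" and v: "v \<in> \<phi> ` R" and w: "w \<in> \<phi> ` R"
      and dvd: "dvd_in (\<phi> ` R) y (v * w)"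
    have "y \<in> \<phi> ` R" using y by (simp add: irreducible_in_def)
    then obtain p a b where p: "p \<in> R" "y = \<phi> p" and a: "a \<in> R" "v = \<phi> a"
      and b: "b \<in> R" "w = \<phi> b" using v w by blast
    have "irreducible_in R p" using y irreducible_in_image p by simp
    moreover have "dvd_in R p (a * b)"
      using dvd dvd_in_image[of p "a * b"] p a b by (simp add: hom_mult)
    ultimately show "dvd_in (\<phi> ` R) y v \<or> dvd_in (\<phi> ` R) y w"
      using irreducible_imp_prime[of p a b] p a b by (simp add: dvd_in_image)
  qed
qed

definition fractions :: "'a::field set \<Rightarrow> 'a set" where
  "fractions R = {a / b | a b. a \<in> R \<and> b \<in> R \<and> b \<noteq> 0}"

lemma fractionsE:
  assumes "y \<in> fractions R"
  obtains a b where "a \<in> R" "b \<in> R" "b \<noteq> 0" "y = a / b"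
  using assms unfolding fractions_def by blast

lemma fractionsI: "a \<in> R \<Longrightarrow> b \<in> R \<Longrightarrow> b \<noteq> 0 \<Longrightarrow> a / b \<in> fractions R"
  unfolding fractions_def by blast

lemma subring_fractions:
  assumes "subring R"
  shows "subring (fractions R)"
proof -
  interpret subring R by fact
  show ?thesis
  proof
    show "0 \<in> fractions R" "1 \<in> fractions R"
      using fractionsI[of 0 R 1] fractionsI[of 1 R 1] by simp_all
  next
    fix y z assume "y \<in> fractions R" "z \<in> fractions R"
    then obtain a b a' b' where *: "a \<in> R" "b \<in> R" "b \<noteq> 0" "y = a / b"
      "a' \<in> R" "b' \<in> R" "b' \<noteq> 0" "z = a' / b'" by (metis fractionsE)
    have "y + z = (a * b' + a' * b) / (b * b')" "y * z = (a * a') / (b * b')"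
      unfolding *(4,8) using *(3,7) by (simp_all add: field_simps)
    then show "y + z \<in> fractions R" "y * z \<in> fractions R"
      using * by (simp_all add: fractionsI)
  next
    fix y assume "y \<in> fractions R"
    then obtain a b where *: "a \<in> R" "b \<in> R" "b \<noteq> 0" "y = a / b" by (rule fractionsE)
    have "- y = (- a) / b" using *(4) by simp
    also have "\<dots> \<in> fractions R" using * by (intro fractionsI) auto
    finally show "- y \<in> fractions R" .
  qed
qed

lemma clear_denominators:
  fixes R :: "'a::field set"
  assumes "subring R" and "B \<in> polys_over (fractions R)"
  shows "\<exists>r\<in>R. r \<noteq> 0 \<and> smult r B \<in> polys_over R"
  using assms(2)
proof (induction B)
  case 0
  interpret subring R by fact
  show ?case using one_closed zero_neq_one by (intro bexI[of _ 1]) (simp_all add: polys_over_def)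
next
  case (pCons b B)
  interpret subring R by fact
  interpret K: subring "fractions R" by (rule subring_fractions) fact
  from pCons obtain r where r: "r \<in> R" "r \<noteq> 0" "smult r B \<in> polys_over R"
    using K.pCons_polys_over by blast
  from pCons have "b \<in> fractions R" using K.pCons_polys_over by blast
  then obtain a s where s: "a \<in> R" "s \<in> R" "s \<noteq> 0" "b = a / s" by (rule fractionsE)
  have "smult (r * s) (pCons b B) = pCons (r * a) (smult s (smult r B))"
    using s by (simp add: mult.commute)
  also have "\<dots> \<in> polys_over R"
    using r s by (simp add: pCons_polys_over smult_polys_over del: smult_smult)
  finally show ?case using r s by (intro bexI[of _ "r * s"]) auto
qed

section \<open>Partial fractions at an irreducible polynomial\<close>

text \<open>
  In the application \<open>R\<close> is \<open>F[\<alpha>\<^sub>1,\<dots>,\<alpha>\<^bsub>n-1\<^esub>]\<close>, \<open>x\<close> is \<open>\<alpha>\<^sub>n\<close>, \<open>P\<close> below is \<open>F[\<alpha>\<^sub>1,\<dots>,\<alpha>\<^sub>n]\<close> as a subset of the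
  field of rational functions, and \<open>K\<close> is \<open>F(\<alpha>\<^sub>1,\<dots>,\<alpha>\<^bsub>n-1\<^esub>)\<close>. Elements of \<open>P\<close> and polynomials over \<open>R\<close>
  correspond to each other because \<open>x\<close> is transcendental.
\<close>

locale irreducible_over_subring = factorial_subring R for R :: "'l::field set" +
  fixes x :: 'l and D :: "'l poly"
  assumes transcendental: "A \<in> polys_over R \<Longrightarrow> poly A x = 0 \<Longrightarrow> A = 0"
    and irreducible_D: "irreducible_in (polys_over R) D"
    and degree_D: "degree D > 0"
begin

abbreviation "P \<equiv> (\<lambda>A. poly A x) ` polys_over R"
abbreviation "K \<equiv> fractions R"
abbreviation "d \<equiv> poly D x"

text \<open>
  The numerators of partial fractions with denominator a power of \<open>d\<close>. Vanishing of the coefficients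
  from \<open>degree D\<close> on expresses the degree bound with the zero polynomial included.
\<close>

definition small :: "'l poly \<Rightarrow> bool" where
  "small B \<longleftrightarrow> B \<in> polys_over K \<and> (\<forall>i\<ge>degree D. coeff B i = 0)"

text \<open>
  The localization of \<open>P\<close> at the prime \<open>d\<close>: the rational functions without a pole at \<open>d\<close>.
\<close>

definition local_ring :: "'l set" where
  "local_ring = {p / q | p q. p \<in> P \<and> q \<in> P \<and> \<not> dvd_in P d q}"

sublocale S: factorial_subring "polys_over R"
  by (rule factorial_polys_over)

sublocale eval: subring_embedding "polys_over R" "\<lambda>A. poly A x"
  by unfold_locales (simp_all add: transcendental)

sublocale P: factorial_subring P
  by (rule factorial_image) (rule S.factorial_subring_axioms eval.subring_embedding_axioms)+

sublocale K: subring K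
  by (rule subring_fractions) (rule subring_axioms)

lemma D_closed: "D \<in> polys_over R"
  using irreducible_D by (simp add: irreducible_in_def)

lemma d_closed: "d \<in> P"
  using D_closed by blast

lemma d_nonzero: "d \<noteq> 0"
  using eval.hom_eq_zero_iff[OF D_closed] degree_D by auto

lemma irreducible_d: "irreducible_in P d"
  using eval.irreducible_in_image[OF D_closed] irreducible_D by simp

lemma dvd_in_zero: "dvd_in P d 0"
  unfolding dvd_in_def by (intro bexI[of _ 0]) simp_all

lemma not_dvd_mult:
  "p \<in> P \<Longrightarrow> q \<in> P \<Longrightarrow> \<not> dvd_in P d p \<Longrightarrow> \<not> dvd_in P d q \<Longrightarrow> \<not> dvd_in P d (p * q)"
  using P.irreducible_imp_prime[OF irreducible_d] by blast

lemma not_dvd_const: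
  assumes "r \<in> R" "r \<noteq> 0"
  shows "\<not> dvd_in P d r"
proof
  assume "dvd_in P d r"
  then have "dvd_in P d (poly [:r:] x)" by simp
  then have "dvd_in (polys_over R) D [:r:]"
    using eval.dvd_in_image[OF D_closed, of "[:r:]"] const_polys_over assms by blast
  then obtain C where C: "[:r:] = D * C" unfolding dvd_in_def by blast
  with assms have "C \<noteq> 0" "D \<noteq> 0" by auto
  then have "degree (D * C) > 0" using degree_D by (simp add: degree_mult_eq)
  then show False unfolding C[symmetric] by simp
qed

lemma local_ringI: "p \<in> P \<Longrightarrow> q \<in> P \<Longrightarrow> \<not> dvd_in P d q \<Longrightarrow> p / q \<in> local_ring"
  unfolding local_ring_def by blast

lemma local_ringE:
  assumes "h \<in> local_ring"
  obtains p q where "p \<in> P" "q \<in> P" "\<not> dvd_in P d q" "q \<noteq> 0" "h = p / q"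
proof -
  from assms obtain p q where "p \<in> P" "q \<in> P" "\<not> dvd_in P d q" "h = p / q"
    unfolding local_ring_def by blast
  moreover from this have "q \<noteq> 0" using dvd_in_zero by blast
  ultimately show ?thesis using that by blast
qed

lemma one_not_dvd: "\<not> dvd_in P d 1"
  using not_dvd_const[of 1] by simp

lemma P_local_ring: "p \<in> P \<Longrightarrow> p \<in> local_ring"
  using local_ringI[of p 1] one_not_dvd P.one_closed by simp

sublocale O: subring local_ring
proof
  show "0 \<in> local_ring" "1 \<in> local_ring"
    using P_local_ring P.zero_closed P.one_closed by blast+
next
  fix g h assume "g \<in> local_ring" "h \<in> local_ring"
  obtain p q where g: "p \<in> P" "q \<in> P" "\<not> dvd_in P d q" "q \<noteq> 0" "g = p / q"
    using \<open>g \<in> local_ring\<close> by (rule local_ringE)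
  obtain p' q' where h: "p' \<in> P" "q' \<in> P" "\<not> dvd_in P d q'" "q' \<noteq> 0" "h = p' / q'"
    using \<open>h \<in> local_ring\<close> by (rule local_ringE)
  have "g + h = (p * q' + p' * q) / (q * q')" "g * h = (p * p') / (q * q')"
    unfolding g(5) h(5) using g(4) h(4) by (simp_all add: field_simps)
  moreover have "\<not> dvd_in P d (q * q')"
    using not_dvd_mult g h by blast
  ultimately show "g + h \<in> local_ring" "g * h \<in> local_ring"
    using g(1,2) h(1,2) by (simp_all only: local_ringI P.add_closed P.mult_closed simp_thms)
next
  fix g assume "g \<in> local_ring"
  then obtain p q where g: "p \<in> P" "q \<in> P" "\<not> dvd_in P d q" "q \<noteq> 0" "g = p / q"
    by (rule local_ringE)
  have "- g = (- p) / q" using g(5) by simp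
  also have "\<dots> \<in> local_ring" using g by (intro local_ringI P.uminus_closed)
  finally show "- g \<in> local_ring" .
qed

lemma R_P: "r \<in> R \<Longrightarrow> r \<in> P"
  using const_polys_over[of r] by (intro image_eqI[of _ _ "[:r:]"]) simp_all

lemma x_P: "x \<in> P"
  using pCons_polys_over by (intro image_eqI[of _ _ "[:0, 1:]"]) (simp_all add: polys_over_def)

lemma K_local_ring: "a \<in> K \<Longrightarrow> a \<in> local_ring"
  by (elim fractionsE) (simp add: local_ringI R_P not_dvd_const)

lemma eval_local_ring: "B \<in> polys_over K \<Longrightarrow> poly B x \<in> local_ring"
proof (induction B)
  case (pCons b B)
  then have "b \<in> K" "B \<in> polys_over K" using K.pCons_polys_over by blast+
  with pCons.IH show ?case using K_local_ring P_local_ring[OF x_P] by simp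
qed simp

text \<open>
  Uniqueness of the leading term of an expansion in powers of \<open>d\<close>. After clearing denominators, \<open>D\<close>
  divides \<open>r C\<close> in \<open>R[X]\<close>, and \<open>C\<close> has smaller degree.
\<close>

lemma small_eval_eq_zero:
  assumes C: "small C" and h: "h \<in> local_ring" "poly C x = d * h"
  shows "C = 0"
proof (rule ccontr)
  assume "C \<noteq> 0"
  from C have "C \<in> polys_over K" by (simp add: small_def)
  with clear_denominators[OF subring_axioms] obtain r
    where r: "r \<in> R" "r \<noteq> 0" "smult r C \<in> polys_over R" by blast
  obtain p q where q: "p \<in> P" "q \<in> P" "\<not> dvd_in P d q" "q \<noteq> 0" "h = p / q"
    using h(1) by (rule local_ringE)
  have "q * poly (smult r C) x = d * (r * p)"
    using q(4) by (simp add: h(2) q(5) field_simps)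
  moreover have "r * p \<in> P" using R_P r q by simp
  ultimately have "dvd_in P d (q * poly (smult r C) x)" unfolding dvd_in_def by blast
  then have "dvd_in P d (poly (smult r C) x)"
    using not_dvd_mult[of q "poly (smult r C) x"] q r by blast
  then have "dvd_in (polys_over R) D (smult r C)"
    using eval.dvd_in_image[OF D_closed r(3)] by simp
  then obtain E where E: "smult r C = D * E" unfolding dvd_in_def by blast
  moreover have "smult r C \<noteq> 0" using r \<open>C \<noteq> 0\<close> by simp
  ultimately have "degree D \<le> degree (smult r C)"
    by (auto simp: degree_mult_eq)
  then have "coeff C (degree C) = 0" using C r(2) by (simp add: small_def)
  then show False using \<open>C \<noteq> 0\<close> by simp
qed

text \<open>
  Existence of the leading term of an expansion in powers of \<open>d\<close>: modulo \<open>d\<close> the denominator \<open>q\<close> is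
  invertible up to the constant \<open>s\<close>, and the resulting numerator \<open>b p\<close> can be reduced by
  pseudo-division, up to the constant \<open>l\<^sup>e\<close>.
\<close>

lemma residue:
  assumes "h \<in> local_ring"
  shows "\<exists>B. small B \<and> (\<exists>h'\<in>local_ring. h = poly B x + d * h')"
proof -
  obtain p q where q: "p \<in> P" "q \<in> P" "\<not> dvd_in P d q" "q \<noteq> 0" "h = p / q"
    using assms by (rule local_ringE)
  then obtain p' q' where p': "p' \<in> polys_over R" "p = poly p' x"
    and q': "q' \<in> polys_over R" "q = poly q' x" by blast
  have "\<not> dvd_in (polys_over R) D q'"
    using eval.dvd_in_image[OF D_closed q'(1)] q(3) q'(2) by simp
  from bezout_irreducible[OF irreducible_D degree_D q'(1) this] obtain a b s
    where s: "a \<in> polys_over R" "b \<in> polys_over R" "s \<in> R" "s \<noteq> 0" "[:s:] = a * D + b * q'"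
    by blast
  have "D \<noteq> 0" using degree_D by auto
  define l where "l = lead_coeff D"
  have l: "l \<in> R" "l \<noteq> 0" using D_closed \<open>D \<noteq> 0\<close> by (simp_all add: l_def polys_over_def)
  have "b * p' \<in> polys_over R" using s p' by simp
  from pseudo_division[OF D_closed \<open>D \<noteq> 0\<close> this] obtain e Q T
    where T: "Q \<in> polys_over R" "T \<in> polys_over R" "smult (l ^ e) (b * p') = Q * D + T"
      "T = 0 \<or> degree T < degree D"
    unfolding l_def by blast
  define m where "m = l ^ e * s"
  have m: "m \<in> R" "m \<noteq> 0" using l s by (simp_all add: m_def)
  define B where "B = smult (1 / m) T"
  have "coeff B i \<in> K" for i
    using T(2) m fractionsI[of "coeff T i" R m] by (simp add: B_def polys_over_def)
  then have "small B"
    using T(4) by (auto simp: small_def polys_over_def B_def coeff_eq_0)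
  moreover
  \<comment> \<open>In \<open>m p - q T(x) = l\<^sup>e p (s - b q) + q (l\<^sup>e b p - T(x))\<close> both brackets are multiples of \<open>d\<close>.\<close>
  let ?w = "l ^ e * p * poly a x + q * poly Q x"
  have "?w / (m * q) \<in> local_ring"
    using not_dvd_mult[OF R_P[OF m(1)] q(2) not_dvd_const[OF m] q(3)] q s T l m R_P[of "l ^ e"] R_P[of m]
    by (intro local_ringI) (auto intro!: P.add_closed P.mult_closed)
  moreover have "h = poly B x + d * (?w / (m * q))"
  proof -
    have s': "s = poly a x * d + poly b x * q"
      using arg_cong[OF s(5), of "\<lambda>A. poly A x"] q'(2) by simp
    have T': "l ^ e * (poly b x * p) = poly Q x * d + poly T x"
      using arg_cong[OF T(3), of "\<lambda>A. poly A x"] p'(2) by simp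
    have "m * p = l ^ e * p * poly a x * d + q * (l ^ e * (poly b x * p))"
      unfolding m_def by (subst s') (simp add: algebra_simps)
    also have "\<dots> = q * poly T x + d * ?w"
      unfolding T' by (simp add: algebra_simps)
    finally have "m * p = q * poly T x + d * ?w" .
    then have "p / q = (q * poly T x + d * ?w) / (m * q)"
      using m q by (simp add: field_simps)
    also have "\<dots> = poly B x + d * (?w / (m * q))"
      using m(2) q(4) by (simp add: B_def add_divide_distrib[of _ "d * ?w"])
    finally show ?thesis using q(5) by simp
  qed
  ultimately show ?thesis by blast
qed

lemma finite_pole_order:
  assumes "g \<in> fractions P"
  shows "\<exists>N. d ^ N * g \<in> local_ring"
proof -
  have power: "\<exists>N. \<exists>Q'\<in>polys_over R. Q = D ^ N * Q' \<and> \<not> dvd_in (polys_over R) D Q'"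
    if "Q \<in> polys_over R" "Q \<noteq> 0" for Q
    using that
  proof (induction "degree Q" arbitrary: Q rule: less_induct)
    case less
    show ?case
    proof (cases "dvd_in (polys_over R) D Q")
      case False
      then show ?thesis using less.prems by (intro exI[of _ 0] bexI[of _ Q]) simp_all
    next
      case True
      then obtain Q1 where Q1: "Q1 \<in> polys_over R" "Q = D * Q1" unfolding dvd_in_def by blast
      with less.prems have "Q1 \<noteq> 0" "D \<noteq> 0" by auto
      then have "degree Q1 < degree Q" using Q1 degree_D by (simp add: degree_mult_eq)
      from less.hyps[OF this Q1(1) \<open>Q1 \<noteq> 0\<close>] obtain N Q' where
        "Q' \<in> polys_over R" "Q1 = D ^ N * Q'" "\<not> dvd_in (polys_over R) D Q'" by blast
      then show ?thesis
        using Q1 by (intro exI[of _ "Suc N"] bexI[of _ Q']) (simp_all add: mult.assoc)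
    qed
  qed
  obtain p q where q: "p \<in> P" "q \<in> P" "q \<noteq> 0" "g = p / q" using assms by (rule fractionsE)
  then obtain Q where Q: "Q \<in> polys_over R" "q = poly Q x" by blast
  with q have "Q \<noteq> 0" by auto
  from power[OF Q(1) this] obtain N Q' where
    Q': "Q' \<in> polys_over R" "Q = D ^ N * Q'" "\<not> dvd_in (polys_over R) D Q'" by blast
  have "q = d ^ N * poly Q' x" using Q(2) Q'(2) by simp
  then have "d ^ N * g = p / poly Q' x" using q(4) d_nonzero by simp
  also have "\<dots> \<in> local_ring"
    using q(1) Q' eval.dvd_in_image[OF D_closed Q'(1)] by (intro local_ringI) auto
  finally show ?thesis by blast
qed

lemma small_combination:
  assumes "small B" "small B'" "small A"
  shows "small (B' - B - A)"
  using assms K.subring_polys_over unfolding small_def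
  by (auto intro!: subring.diff_closed)

text \<open>
  The heart of the necessity proof. Think of \<open>\<tau>\<close> as \<open>c\<^sup>k \<sigma>\<^sup>k\<close>: it is additive, acts on partial fractions
  with denominator \<open>d\<^sup>N\<close> for each \<open>N\<close> separately, and does not increase pole orders at \<open>d\<close>. Let \<open>g\<close> have
  pole order at most \<open>j + m\<close>. If \<open>m > 0\<close>, the left-hand side has a smaller pole order, so the leading
  term \<open>B / d\<^bsup>j+m\<^esup>\<close> of \<open>g\<close> contributes nothing to \<open>\<tau> g - g\<close> and can be removed from \<open>g\<close>. When \<open>m = 0\<close>
  is reached, the terms with denominator \<open>d\<^sup>j\<close> on both sides agree, which is the claim.
\<close>

lemma compare_top_coefficients:
  assumes add: "\<And>g h. g \<in> fractions P \<Longrightarrow> h \<in> fractions P \<Longrightarrow> \<tau> (g + h) = \<tau> g + \<tau> h"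
    and top: "\<And>B N. small B \<Longrightarrow> \<exists>B'. small B' \<and> \<tau> (poly B x / d ^ N) = poly B' x / d ^ N"
    and pole: "\<And>g N. d ^ N * g \<in> local_ring \<Longrightarrow> d ^ N * \<tau> g \<in> local_ring"
    and A: "small A" and j: "j \<ge> 1" and r: "r \<in> local_ring"
    and g: "g \<in> fractions P" "poly A x / d ^ j + r = \<tau> g - g"
  shows "\<exists>B. small B \<and> poly A x / d ^ j = \<tau> (poly B x / d ^ j) - poly B x / d ^ j"
proof -
  have in_fractions: "g \<in> fractions P" if "d ^ N * g \<in> local_ring" for g N
  proof -
    from that obtain p q where q: "p \<in> P" "q \<in> P" "\<not> dvd_in P d q" "q \<noteq> 0" "d ^ N * g = p / q"
      by (rule local_ringE)
    then have "g = p / (d ^ N * q)" using d_nonzero by (simp add: field_simps)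
    then show ?thesis using q d_closed d_nonzero by (simp add: fractionsI)
  qed
  have d_mult: "d * h \<in> local_ring" "d ^ N * h \<in> local_ring" if "h \<in> local_ring" for h N
    using that P_local_ring[OF d_closed] by simp_all
  have split_top: "\<exists>B B' g1. small B \<and> small B' \<and>
      \<tau> (poly B x / d ^ Suc N) = poly B' x / d ^ Suc N \<and> d ^ N * g1 \<in> local_ring \<and>
      g = poly B x / d ^ Suc N + g1 \<and>
      d ^ Suc N * (\<tau> g - g) = poly (B' - B) x + d * (d ^ N * (\<tau> g1 - g1)) \<and>
      \<tau> g = poly B' x / d ^ Suc N + \<tau> g1"
    if "d ^ Suc N * g \<in> local_ring" for N g
  proof -
    from residue[OF that] obtain B h where B: "small B" "h \<in> local_ring"
      "d ^ Suc N * g = poly B x + d * h" by blast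
    from top[OF B(1)] obtain B' where B': "small B'" "\<tau> (poly B x / d ^ Suc N) = poly B' x / d ^ Suc N"
      by blast
    define g1 where "g1 = h / d ^ N"
    have g1: "d ^ N * g1 \<in> local_ring" using B(2) d_nonzero by (simp add: g1_def)
    have "g = (poly B x + d * h) / d ^ Suc N"
      unfolding B(3)[symmetric] using d_nonzero by simp
    also have "\<dots> = poly B x / d ^ Suc N + g1"
      using d_nonzero by (simp add: g1_def add_divide_distrib)
    finally have g: "g = poly B x / d ^ Suc N + g1" .
    have "d ^ Suc N * (poly B x / d ^ Suc N) \<in> local_ring"
      using eval_local_ring B(1) d_nonzero by (simp add: small_def)
    then have "\<tau> g = \<tau> (poly B x / d ^ Suc N) + \<tau> g1"
      unfolding g by (intro add in_fractions[OF g1]) (rule in_fractions)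
    then have \<tau>_g: "\<tau> g = poly B' x / d ^ Suc N + \<tau> g1" unfolding B'(2) .
    have "d ^ Suc N * (poly C x / d ^ Suc N) = poly C x" for C using d_nonzero by simp
    then have "d ^ Suc N * (\<tau> g - g) = poly (B' - B) x + d * (d ^ N * (\<tau> g1 - g1))"
      unfolding \<tau>_g by (subst g) (simp only: algebra_simps power_Suc poly_diff)
    with B(1) B' g1 g \<tau>_g show ?thesis by blast
  qed
  have main: "\<exists>B. small B \<and> poly A x / d ^ j = \<tau> (poly B x / d ^ j) - poly B x / d ^ j"
    if "d ^ (j + m) * g \<in> local_ring" "poly A x / d ^ j + r = \<tau> g - g" for m g
    using that
  proof (induction m arbitrary: g)
    case (0 g)
    obtain B B' g1 where B: "small B" "small B'"
      "\<tau> (poly B x / d ^ j) = poly B' x / d ^ j" "d ^ (j - 1) * g1 \<in> local_ring"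
      and diff: "d ^ j * (\<tau> g - g) = poly (B' - B) x + d * (d ^ (j - 1) * (\<tau> g1 - g1))"
      using split_top[of "j - 1" g] 0 j by auto
    have "d ^ j * (poly A x / d ^ j + r) = poly A x + d ^ j * r"
      using d_nonzero by (simp add: distrib_left)
    then have "poly (B' - B - A) x = d ^ j * r - d * (d ^ (j - 1) * (\<tau> g1 - g1))"
      using diff unfolding 0(2)[symmetric] by (simp add: algebra_simps)
    also have "\<dots> = d * (d ^ (j - 1) * r - d ^ (j - 1) * (\<tau> g1 - g1))"
      using j by (simp add: right_diff_distrib power_eq_if)
    finally have "poly (B' - B - A) x = d * (d ^ (j - 1) * r - d ^ (j - 1) * (\<tau> g1 - g1))" .
    moreover have "d ^ (j - 1) * r - d ^ (j - 1) * (\<tau> g1 - g1) \<in> local_ring"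
      using d_mult(2)[OF r] B(4) pole[OF B(4)] by (simp add: right_diff_distrib)
    ultimately have "B' - B - A = 0"
      using small_eval_eq_zero[OF small_combination[OF B(1,2) A]] by blast
    then have "A = B' - B" by simp
    with B show ?case by (intro exI[of _ B]) (simp add: diff_divide_distrib)
  next
    case (Suc m g)
    obtain B B' g1 where B: "small B" "small B'"
      "\<tau> (poly B x / d ^ (j + Suc m)) = poly B' x / d ^ (j + Suc m)" "d ^ (j + m) * g1 \<in> local_ring"
      and g_eq: "g = poly B x / d ^ (j + Suc m) + g1"
      and diff: "d ^ (j + Suc m) * (\<tau> g - g) = poly (B' - B) x + d * (d ^ (j + m) * (\<tau> g1 - g1))"
      and \<tau>_g: "\<tau> g = poly B' x / d ^ (j + Suc m) + \<tau> g1"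
      using split_top[of "j + m" g] Suc.prems(1) by auto
    have "d ^ (j + Suc m) * (poly A x / d ^ j + r) = d * (d ^ m * poly A x + d ^ (j + m) * r)"
      using d_nonzero by (simp add: field_simps power_add)
    then have "poly (B' - B) x = d * (d ^ m * poly A x + d ^ (j + m) * r - d ^ (j + m) * (\<tau> g1 - g1))"
      using diff unfolding Suc.prems(2)[symmetric] by (simp add: algebra_simps)
    moreover have "d ^ m * poly A x + d ^ (j + m) * r - d ^ (j + m) * (\<tau> g1 - g1) \<in> local_ring"
      using d_mult(2)[OF r] B(4) pole[OF B(4)] d_mult(2)[OF eval_local_ring] A
      by (simp add: right_diff_distrib small_def)
    moreover have "small (B' - B - 0)"
      by (rule small_combination) (use B in \<open>simp_all add: small_def polys_over_def\<close>)
    ultimately have "B' - B = 0"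
      using small_eval_eq_zero[of "B' - B"] by simp
    then have "\<tau> g1 - g1 = \<tau> g - g" using g_eq \<tau>_g by simp
    with Suc.prems(2) Suc.IH[OF B(4)] show ?case by simp
  qed
  from finite_pole_order[OF g(1)] obtain N where N: "d ^ N * g \<in> local_ring" by blast
  then have "d ^ (j + N) * g \<in> local_ring"
    using d_mult(2)[OF N, of j] by (simp add: power_add mult.assoc)
  then show ?thesis using main g(2) by blast
qed

end

section \<open>Automorphisms that scale the last variable\<close>

locale subfield_automorphism = subring L for L :: "'l::field set" +
  fixes s :: "'l \<Rightarrow> 'l"
  assumes inverse_closed: "a \<in> L \<Longrightarrow> inverse a \<in> L"
    and bij: "bij_betw s L L"
    and hom_add: "a \<in> L \<Longrightarrow> b \<in> L \<Longrightarrow> s (a + b) = s a + s b"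
    and hom_mult: "a \<in> L \<Longrightarrow> b \<in> L \<Longrightarrow> s (a * b) = s a * s b"
begin

lemma hom_closed: "a \<in> L \<Longrightarrow> s a \<in> L"
  using bij bij_betwE by blast

lemma hom_eq_iff: "a \<in> L \<Longrightarrow> b \<in> L \<Longrightarrow> s a = s b \<longleftrightarrow> a = b"
  using bij by (meson bij_betw_imp_inj_on inj_onD)

lemma hom_zero: "s 0 = 0"
  using hom_add[of 0 0] by (metis add.right_neutral add_left_cancel zero_closed)

lemma hom_eq_zero_iff: "a \<in> L \<Longrightarrow> s a = 0 \<longleftrightarrow> a = 0"
  using hom_eq_iff[of a 0] hom_zero by simp

lemma hom_one: "s 1 = 1"
  using hom_mult[of 1 1] hom_eq_zero_iff[of 1] by simp

lemma hom_uminus: "a \<in> L \<Longrightarrow> s (- a) = - s a"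
  using hom_add[of a "- a"] hom_zero by (simp add: eq_neg_iff_add_eq_0 add.commute)

lemma hom_diff: "a \<in> L \<Longrightarrow> b \<in> L \<Longrightarrow> s (a - b) = s a - s b"
  using hom_add[of a "- b"] hom_uminus by simp

lemma hom_power: "a \<in> L \<Longrightarrow> s (a ^ m) = s a ^ m"
  by (induction m) (simp_all add: hom_one hom_mult)

lemma divide_closed: "a \<in> L \<Longrightarrow> b \<in> L \<Longrightarrow> a / b \<in> L"
  by (simp add: divide_inverse inverse_closed)

lemma hom_divide:
  assumes "a \<in> L" "b \<in> L"
  shows "s (a / b) = s a / s b"
proof (cases "b = 0")
  case False
  have "s (a / b) * s b = s a"
    using assms False by (simp flip: hom_mult add: divide_closed)
  then show ?thesis using assms False hom_eq_zero_iff by (simp add: field_simps)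
qed (simp add: hom_zero)

end

text \<open>
  An automorphism of the field of rational functions that preserves \<open>R\<close> and multiplies \<open>x\<close> by an
  element of \<open>R\<close>. Both \<open>\<sigma>\<close> and its iterates are of this kind, with different multipliers.
\<close>

locale coordinate_scaling = irreducible_over_subring R x D
  for R :: "'l::field set" and x D +
  fixes s :: "'l \<Rightarrow> 'l" and \<mu> :: 'l
  assumes automorphism: "subfield_automorphism (fractions ((\<lambda>A. poly A x) ` polys_over R)) s"
    and image_R: "s ` R = R"
    and image_P: "s ` ((\<lambda>A. poly A x) ` polys_over R) = (\<lambda>A. poly A x) ` polys_over R"
    and hom_x: "s x = \<mu> * x"
    and multiplier: "\<mu> \<in> R"
begin

abbreviation "L \<equiv> fractions P"

sublocale L: subfield_automorphism L s
  by (rule automorphism)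

lemma P_L: "p \<in> P \<Longrightarrow> p \<in> L"
  using fractionsI[of p P 1] P.one_closed by simp

lemma K_L: "a \<in> K \<Longrightarrow> a \<in> L"
  by (elim fractionsE) (simp add: L.divide_closed P_L R_P)

lemma local_ring_L: "h \<in> local_ring \<Longrightarrow> h \<in> L"
  by (elim local_ringE) (simp add: fractionsI)

lemma eval_L: "B \<in> polys_over K \<Longrightarrow> poly B x \<in> L"
  using eval_local_ring local_ring_L by blast

lemma hom_K:
  assumes "a \<in> K"
  shows "s a \<in> K"
proof -
  obtain p q where q: "p \<in> R" "q \<in> R" "q \<noteq> 0" "a = p / q" using assms by (rule fractionsE)
  then have "p \<in> L" "q \<in> L" by (simp_all add: P_L R_P)
  then have "s a = s p / s q" "s q \<noteq> 0"
    using L.hom_divide L.hom_eq_zero_iff q(3,4) by simp_all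
  moreover have "s p \<in> R" "s q \<in> R" using q(1,2) image_R by blast+
  ultimately show ?thesis by (simp add: fractionsI)
qed

text \<open>
  Applying \<open>s\<close> to the coefficients and scaling the variable does not create terms of higher degree.
\<close>

lemma hom_small:
  assumes "small B"
  shows "\<exists>B'. small B' \<and> s (poly B x) = poly B' x"
proof -
  have "\<exists>B'\<in>polys_over K. s (poly B x) = poly B' x \<and> (\<forall>i. coeff B i = 0 \<longrightarrow> coeff B' i = 0)"
    if "B \<in> polys_over K" for B
    using that
  proof (induction B)
    case 0
    then show ?case by (intro bexI[of _ 0]) (simp_all add: L.hom_zero)
  next
    case (pCons b B)
    then have b: "b \<in> K" and B: "B \<in> polys_over K" using K.pCons_polys_over by blast+
    from pCons.IH[OF B] obtain B' where
      B': "B' \<in> polys_over K" "s (poly B x) = poly B' x" "\<And>i. coeff B i = 0 \<Longrightarrow> coeff B' i = 0"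
      by blast
    have "s (poly (pCons b B) x) = s b + \<mu> * x * poly B' x"
      using b B by (simp add: L.hom_add L.hom_mult K_L eval_L P_L x_P hom_x B'(2))
    also have "\<dots> = poly (pCons (s b) (smult \<mu> B')) x"
      by (simp add: ac_simps)
    finally have "s (poly (pCons b B) x) = poly (pCons (s b) (smult \<mu> B')) x" .
    moreover have "\<mu> \<in> K" using fractionsI[of \<mu> R 1] multiplier by simp
    then have "pCons (s b) (smult \<mu> B') \<in> polys_over K"
      using hom_K[OF b] B'(1) by (simp add: K.pCons_polys_over K.smult_polys_over)
    moreover have "coeff (pCons (s b) (smult \<mu> B')) i = 0" if "coeff (pCons b B) i = 0" for i
      using that B'(3) by (auto simp: coeff_pCons L.hom_zero split: nat.splits)
    ultimately show ?case by blast
  qed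
  with assms show ?thesis unfolding small_def by blast
qed

lemma unit_hom: "p \<in> P \<Longrightarrow> unit_in P (s p) \<longleftrightarrow> unit_in P p"
proof
  assume p: "p \<in> P" and "unit_in P (s p)"
  then obtain y where "y \<in> P" "s p * y = 1" unfolding unit_in_def by blast
  moreover from this obtain y' where y': "y' \<in> P" "y = s y'" using image_P by blast
  ultimately have "s (p * y') = s 1" using p by (simp add: L.hom_mult P_L L.hom_one)
  then have "p * y' = 1" using L.hom_eq_iff p y' by (simp add: P_L)
  with p y' show "unit_in P p" unfolding unit_in_def by blast
next
  assume p: "p \<in> P" and "unit_in P p"
  then obtain y where y: "y \<in> P" "p * y = 1" unfolding unit_in_def by blast
  then have "s p * s y = 1" using L.hom_mult[of p y] p by (simp add: P_L L.hom_one)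
  moreover have "s p \<in> P" "s y \<in> P" using p y image_P by blast+
  ultimately show "unit_in P (s p)" unfolding unit_in_def by blast
qed

lemma irreducible_hom:
  assumes "irreducible_in P p"
  shows "irreducible_in P (s p)"
proof -
  have p: "p \<in> P" "p \<noteq> 0" "\<not> unit_in P p" using assms by (auto simp: irreducible_in_def)
  have "unit_in P v \<or> unit_in P w" if vw: "v \<in> P" "w \<in> P" "s p = v * w" for v w
  proof -
    obtain v' w' where *: "v' \<in> P" "v = s v'" "w' \<in> P" "w = s w'"
      using vw image_P by blast
    then have "s p = s (v' * w')" using vw by (simp add: L.hom_mult P_L)
    then have "p = v' * w'" using L.hom_eq_iff p * by (simp add: P_L)
    from irreducible_in_factors[OF assms *(1,3) this] show ?thesis
      using unit_hom * by blast
  qed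
  moreover have "s p \<in> P" using p image_P by blast
  moreover have "s p \<noteq> 0" using p L.hom_eq_zero_iff by (simp add: P_L)
  ultimately show ?thesis using p unit_hom unfolding irreducible_in_def by blast
qed

lemma coordinate_scaling_iterate: "\<exists>\<mu>'. coordinate_scaling R x D (s ^^ i) \<mu>'"
proof (induction i)
  case 0
  have "coordinate_scaling R x D (s ^^ 0) 1"
    by unfold_locales (simp_all add: L.inverse_closed bij_betw_def inj_on_def)
  then show ?case by blast
next
  case (Suc i)
  then obtain \<mu>' where si: "coordinate_scaling R x D (s ^^ i) \<mu>'" by blast
  interpret si: subfield_automorphism L "s ^^ i"
    by (rule coordinate_scaling.automorphism[OF si])
  have R: "(s ^^ Suc i) ` R = R"
    using image_R coordinate_scaling.image_R[OF si] by (simp only: funpow.simps(2) image_comp[symmetric])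
  have P: "(s ^^ Suc i) ` P = P"
    using image_P coordinate_scaling.image_P[OF si] by (simp only: funpow.simps(2) image_comp[symmetric])
  have \<mu>': "\<mu>' \<in> P" "s \<mu>' \<in> R"
    using coordinate_scaling.multiplier[OF si] image_R R_P by blast+
  have "bij_betw (s ^^ Suc i) L L"
    using bij_betw_trans[OF si.bij L.bij] by simp
  moreover have "(s ^^ Suc i) x = s \<mu>' * \<mu> * x"
    using \<mu>'(1) by (simp add: coordinate_scaling.hom_x[OF si] L.hom_mult P_L x_P hom_x)
  moreover have "s \<mu>' * \<mu> \<in> R" using \<mu>' multiplier by simp
  moreover have "subfield_automorphism L (s ^^ Suc i)"
  proof
    show "bij_betw (s ^^ Suc i) L L" by fact
  qed (simp_all add: L.inverse_closed L.hom_add L.hom_mult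
        si.hom_add si.hom_mult si.hom_closed)
  ultimately have "coordinate_scaling R x D (s ^^ Suc i) (s \<mu>' * \<mu>)"
    using R P
    by (intro coordinate_scaling.intro coordinate_scaling_axioms.intro irreducible_over_subring_axioms)
  then show ?case by blast
qed

end

text \<open>
  The set \<open>C\<close> stands for the constants from \<open>F\<close>. The last assumption says that no \<open>\<sigma>\<^sup>i(d)\<close> with
  \<open>0 < i < k\<close> is associated to \<open>d\<close>, which is what \<open>Spr\<^sub>\<sigma>(d, d) = k\<int>\<close> provides.
\<close>

locale scaled_pole = coordinate_scaling R x D \<sigma> \<mu>
  for R :: "'l::field set" and x D \<sigma> \<mu> +
  fixes C :: "'l set" and c u :: 'l and j k :: nat
  assumes C_R: "C \<subseteq> R"
    and fixed: "a \<in> C \<Longrightarrow> \<sigma> a = a"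
    and units: "unit_in ((\<lambda>A. poly A x) ` polys_over R) w \<Longrightarrow> w \<in> C"
    and c: "c \<in> C"
    and u: "u \<in> C" "u \<noteq> 0"
    and period: "(\<sigma> ^^ k) (poly D x) = u * poly D x"
    and k: "k \<ge> 1" and j: "j \<ge> 1"
    and not_associate: "0 < i \<Longrightarrow> i < k \<Longrightarrow> w \<in> C \<Longrightarrow> (\<sigma> ^^ i) (poly D x) \<noteq> w * poly D x"
begin

text \<open>
  Some factor by which \<open>\<sigma>\<^sup>i\<close> multiplies \<open>x\<close>, named so that the results on coordinate scalings apply to
  all iterates at once.
\<close>

definition scale :: "nat \<Rightarrow> 'l" where
  "scale i = (SOME \<mu>'. coordinate_scaling R x D (\<sigma> ^^ i) \<mu>')"

sublocale it: coordinate_scaling R x D "\<sigma> ^^ i" "scale i" for i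
  unfolding scale_def
  using coordinate_scaling_iterate by (rule someI_ex)

lemma fixed_iterate: "a \<in> C \<Longrightarrow> (\<sigma> ^^ i) a = a"
  by (induction i) (simp_all add: fixed)

lemma C_P: "a \<in> C \<Longrightarrow> a \<in> P"
  using C_R R_P by blast

lemma C_L: "a \<in> C \<Longrightarrow> a \<in> L"
  using C_P P_L by blast

lemma d_L: "d \<in> L"
  using d_closed P_L by blast

lemma hom_k_d_power: "(\<sigma> ^^ k) (d ^ N) = u ^ N * d ^ N"
  by (simp add: it.L.hom_power d_L period power_mult_distrib)

text \<open>
  With \<open>m = k\<close> this turns a solution for \<open>c\<^sup>k \<sigma>\<^sup>k\<close> into one for \<open>c \<sigma>\<close>, which gives sufficiency.
\<close>

lemma telescope:
  assumes "h \<in> L"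
  shows "(\<Sum>i<m. c ^ i * (\<sigma> ^^ i) h) \<in> L \<and>
    c * \<sigma> (\<Sum>i<m. c ^ i * (\<sigma> ^^ i) h) - (\<Sum>i<m. c ^ i * (\<sigma> ^^ i) h) = c ^ m * (\<sigma> ^^ m) h - h"
proof (induction m)
  case 0
  then show ?case by (simp add: L.hom_zero)
next
  case (Suc m)
  have m: "c ^ m * (\<sigma> ^^ m) h \<in> L" using c assms it.L.hom_closed by (simp add: C_L)
  have "\<sigma> (c ^ m * (\<sigma> ^^ m) h) = c ^ m * (\<sigma> ^^ Suc m) h"
    using c assms it.L.hom_closed by (simp add: C_L L.hom_mult L.hom_power fixed)
  then show ?case using Suc m by (simp add: L.hom_add algebra_simps)
qed

text \<open>
  The converse passage, from \<open>c \<sigma>\<close> to \<open>c\<^sup>m \<sigma>\<^sup>m\<close>, adds the equations that result from applying \<open>c\<^sup>i \<sigma>\<^sup>i\<close>.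
\<close>

lemma sum_of_iterates:
  assumes "g \<in> L" "f = c * \<sigma> g - g"
  shows "(\<Sum>i<m. c ^ i * (\<sigma> ^^ i) f) = c ^ m * (\<sigma> ^^ m) g - g"
proof (induction m)
  case (Suc m)
  have "(\<sigma> ^^ m) f = c * (\<sigma> ^^ Suc m) g - (\<sigma> ^^ m) g"
    unfolding assms(2) using assms(1) c
    by (simp add: it.L.hom_diff it.L.hom_mult C_L L.hom_closed fixed_iterate funpow_swap1)
  then have "c ^ m * (\<sigma> ^^ m) f = c ^ Suc m * (\<sigma> ^^ Suc m) g - c ^ m * (\<sigma> ^^ m) g"
    by (simp add: right_diff_distrib)
  then show ?case using Suc by simp
qed simp

text \<open>
  Since \<open>\<sigma>\<^sup>i(d)\<close> is irreducible, it could be divisible by \<open>d\<close> only if the two differ by a unit of \<open>P\<close>,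
  that is, by a constant.
\<close>

lemma not_dvd_iterate:
  assumes i: "0 < i" "i < k"
  shows "\<not> dvd_in P d ((\<sigma> ^^ i) d)"
proof
  assume "dvd_in P d ((\<sigma> ^^ i) d)"
  then obtain w where w: "w \<in> P" "(\<sigma> ^^ i) d = d * w" unfolding dvd_in_def by blast
  from irreducible_in_factors[OF it.irreducible_hom[OF irreducible_d] d_closed this]
  have "unit_in P w" using irreducible_d unfolding irreducible_in_def by blast
  with units have "w \<in> C" by blast
  from not_associate[OF i this] w(2) show False by (simp add: mult.commute)
qed

lemma not_dvd_power: "p \<in> P \<Longrightarrow> \<not> dvd_in P d p \<Longrightarrow> \<not> dvd_in P d (p ^ m)"
  by (induction m) (simp_all add: one_not_dvd not_dvd_mult)

text \<open>
  Of the iterates of \<open>a / d\<^sup>j\<close> with index below \<open>k\<close>, only the one with index \<open>0\<close> can have a pole at \<open>d\<close>.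
\<close>

lemma iterate_regular:
  assumes i: "0 < i" "i < k" and A: "small A"
  shows "c ^ i * (\<sigma> ^^ i) (poly A x / d ^ j) \<in> local_ring"
proof -
  obtain A' where A': "small A'" "(\<sigma> ^^ i) (poly A x) = poly A' x"
    using it.hom_small[OF A] by blast
  have P: "(\<sigma> ^^ i) d \<in> P" using it.image_P d_closed by blast
  have "poly A x \<in> L" using A by (simp add: small_def eval_L)
  then have eq: "(\<sigma> ^^ i) (poly A x / d ^ j) = poly A' x * (1 / ((\<sigma> ^^ i) d) ^ j)"
    by (simp add: it.L.hom_divide d_L it.L.hom_power A'(2))
  have "1 / ((\<sigma> ^^ i) d) ^ j \<in> local_ring"
    using not_dvd_power[OF P not_dvd_iterate[OF i]] P by (intro local_ringI) simp_all
  moreover have "c ^ i \<in> local_ring" using c C_P P_local_ring by simp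
  moreover have "poly A' x \<in> local_ring" using eval_local_ring A'(1) by (simp add: small_def)
  ultimately show ?thesis
    unfolding eq by (intro O.mult_closed)
qed

text \<open>
  \<open>\<sigma>\<^sup>k\<close> maps \<open>P\<close> onto itself and \<open>d\<close> to an associate, so it preserves the denominators prime to \<open>d\<close>.
\<close>

lemma local_ring_stable:
  assumes "h \<in> local_ring"
  shows "(\<sigma> ^^ k) h \<in> local_ring"
proof -
  obtain p q where q: "p \<in> P" "q \<in> P" "\<not> dvd_in P d q" "q \<noteq> 0" "h = p / q"
    using assms by (rule local_ringE)
  have "\<not> dvd_in P d ((\<sigma> ^^ k) q)"
  proof
    assume "dvd_in P d ((\<sigma> ^^ k) q)"
    then obtain w where "w \<in> P" "(\<sigma> ^^ k) q = d * w" unfolding dvd_in_def by blast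
    moreover from this obtain w' where w': "w' \<in> P" "w = (\<sigma> ^^ k) w'" using it.image_P[of k] by blast
    ultimately have "(\<sigma> ^^ k) (u * q) = (\<sigma> ^^ k) (d * w')"
      using u q(2) by (simp add: it.L.hom_mult C_L P_L d_L fixed_iterate period)
    then have "u * q = d * w'"
      using it.L.hom_eq_iff u q(2) w' by (simp add: C_L P_L d_L)
    then have "dvd_in P d (u * q)" using w' unfolding dvd_in_def by blast
    moreover have "\<not> dvd_in P d u" using not_dvd_const u C_R by blast
    ultimately show False using not_dvd_mult[OF C_P[OF u(1)] q(2)] q(3) by blast
  qed
  moreover have "(\<sigma> ^^ k) p \<in> P" "(\<sigma> ^^ k) q \<in> P" using q it.image_P[of k] by blast+
  ultimately show ?thesis
    using q by (simp add: it.L.hom_divide P_L local_ringI)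
qed

theorem summable_iff:
  assumes A: "small A"
  shows "(\<exists>g\<in>L. poly A x / d ^ j = c * \<sigma> g - g) \<longleftrightarrow>
    (\<exists>B. small B \<and> poly A x = c ^ k * inverse u ^ j * (\<sigma> ^^ k) (poly B x) - poly B x)"
proof -
  define \<tau> where "\<tau> g = c ^ k * (\<sigma> ^^ k) g" for g
  have uR: "u \<in> R" and cR: "c \<in> R" using u c C_R by blast+
  have \<tau>_top: "\<tau> (poly B x / d ^ N) = c ^ k * inverse u ^ N * (\<sigma> ^^ k) (poly B x) / d ^ N"
    if "small B" for B N
    using that u(2) d_nonzero
    by (simp add: \<tau>_def small_def it.L.hom_divide eval_L d_L hom_k_d_power field_simps)
  show ?thesis
  proof
    assume "\<exists>g\<in>L. poly A x / d ^ j = c * \<sigma> g - g"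
    then obtain g where g: "g \<in> L" "poly A x / d ^ j = c * \<sigma> g - g" by blast
    let ?r = "\<Sum>i\<in>{1..<k}. c ^ i * (\<sigma> ^^ i) (poly A x / d ^ j)"
    \<comment> \<open>The term with index \<open>0\<close> carries the pole at \<open>d\<close>; all others go into \<open>r\<close>.\<close>
    have "{..<k} = insert 0 {1..<k}" using k by auto
    then have sum: "poly A x / d ^ j + ?r = \<tau> g - g"
      using sum_of_iterates[OF g, of k] by (simp add: \<tau>_def)
    have r: "?r \<in> local_ring"
      by (intro O.sum_closed iterate_regular A) auto
    have "\<exists>B. small B \<and> poly A x / d ^ j = \<tau> (poly B x / d ^ j) - poly B x / d ^ j"
    proof (rule compare_top_coefficients[where \<tau> = \<tau>, OF _ _ _ A j r g(1) sum])
      fix g h assume "g \<in> L" "h \<in> L"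
      then show "\<tau> (g + h) = \<tau> g + \<tau> h" by (simp add: \<tau>_def it.L.hom_add distrib_left)
    next
      fix B N assume B: "small B"
      obtain B' where B': "small B'" "(\<sigma> ^^ k) (poly B x) = poly B' x"
        using it.hom_small[OF B] by blast
      have "inverse u = 1 / u" by (simp add: divide_inverse)
      also have "1 / u \<in> K" using u(2) uR by (intro fractionsI) simp_all
      finally have "inverse u \<in> K" .
      moreover have "c \<in> K" using fractionsI[of c R 1] cR by simp
      ultimately have "small (smult (c ^ k * inverse u ^ N) B')"
        using B'(1) by (simp add: small_def K.smult_polys_over)
      moreover have "\<tau> (poly B x / d ^ N) = poly (smult (c ^ k * inverse u ^ N) B') x / d ^ N"
        using \<tau>_top[OF B] B'(2) by simp
      ultimately show "\<exists>B'. small B' \<and> \<tau> (poly B x / d ^ N) = poly B' x / d ^ N" by blast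
    next
      fix g N assume h: "d ^ N * g \<in> local_ring"
      have "g = (d ^ N * g) / d ^ N" using d_nonzero by simp
      also have "\<dots> \<in> L" by (intro L.divide_closed local_ring_L h L.power_closed d_L)
      finally have "g \<in> L" .
      then have "(\<sigma> ^^ k) (d ^ N * g) = u ^ N * d ^ N * (\<sigma> ^^ k) g"
        by (simp add: it.L.hom_mult d_L hom_k_d_power)
      then have "d ^ N * \<tau> g = c ^ k * (1 / u ^ N) * (\<sigma> ^^ k) (d ^ N * g)"
        using u(2) by (simp add: \<tau>_def)
      moreover have "1 / u ^ N \<in> local_ring"
        using uR u(2) by (intro local_ringI) (simp_all add: R_P not_dvd_const)
      moreover have "c ^ k \<in> local_ring" using c C_P P_local_ring by simp
      ultimately show "d ^ N * \<tau> g \<in> local_ring"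
        using local_ring_stable[OF h] by (simp only: O.mult_closed)
    qed
    then obtain B where B: "small B" "poly A x / d ^ j = \<tau> (poly B x / d ^ j) - poly B x / d ^ j"
      by blast
    then have "poly A x = c ^ k * inverse u ^ j * (\<sigma> ^^ k) (poly B x) - poly B x"
      using \<tau>_top[OF B(1), of j] d_nonzero by (simp flip: diff_divide_distrib)
    with B(1) show "\<exists>B. small B \<and> poly A x = c ^ k * inverse u ^ j * (\<sigma> ^^ k) (poly B x) - poly B x"
      by blast
  next
    assume "\<exists>B. small B \<and> poly A x = c ^ k * inverse u ^ j * (\<sigma> ^^ k) (poly B x) - poly B x"
    then obtain B where B: "small B"
      "poly A x = c ^ k * inverse u ^ j * (\<sigma> ^^ k) (poly B x) - poly B x" by blast
    let ?h = "poly B x / d ^ j"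
    have "?h \<in> L" using B(1) by (simp add: small_def L.divide_closed eval_L d_L)
    from telescope[OF this, of k] obtain g where "g \<in> L" "c * \<sigma> g - g = \<tau> ?h - ?h"
      unfolding \<tau>_def by blast
    then show "\<exists>g\<in>L. poly A x / d ^ j = c * \<sigma> g - g"
      using \<tau>_top[OF B(1), of j] B(2) by (intro bexI[of _ g]) (simp_all add: diff_divide_distrib)
  qed
qed

end

section \<open>Multivariate polynomials as iterated univariate polynomials\<close>

lemma subfield_of_Qbar_closed:
  assumes "subfield_of_Qbar F"
  shows "0 \<in> F" "1 \<in> F" "a \<in> F \<Longrightarrow> b \<in> F \<Longrightarrow> a + b \<in> F" "a \<in> F \<Longrightarrow> b \<in> F \<Longrightarrow> a * b \<in> F"
    "a \<in> F \<Longrightarrow> - a \<in> F" "a \<in> F \<Longrightarrow> inverse a \<in> F"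
  using assms unfolding subfield_of_Qbar_def by blast+

lemma sum_of_monomials:
  fixes p :: cmpoly
  shows "p = (\<Sum>m\<in>Poly_Mapping.keys p. Poly_Mapping.single m (Poly_Mapping.lookup p m))"
  by (rule poly_mapping_eqI) (auto simp: lookup_sum lookup_single when_def sum.delta in_keys_iff)

lemma single_mpolys: "a \<in> F \<Longrightarrow> 0 \<in> F \<Longrightarrow> Poly_Mapping.keys m \<subseteq> V \<Longrightarrow> Poly_Mapping.single m a \<in> mpolys F V"
  by (auto simp: mpolys_def lookup_single when_def)

lemma var_mpolys: "0 \<in> F \<Longrightarrow> 1 \<in> F \<Longrightarrow> i \<in> V \<Longrightarrow> var i \<in> mpolys F V"
  unfolding var_def by (rule single_mpolys) auto

lemma subring_mpolys:
  assumes "subfield_of_Qbar F"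
  shows "subring (mpolys F V)"
proof -
  note F = subfield_of_Qbar_closed[OF assms]
  have zero: "0 \<in> mpolys F V" using F by (simp add: mpolys_def)
  have add: "p + q \<in> mpolys F V" if pq: "p \<in> mpolys F V" "q \<in> mpolys F V" for p q
    using pq F(3) keys_add[of p q] by (fastforce simp: mpolys_def lookup_add)
  have sum: "sum h I \<in> mpolys F V" if "\<And>i. i \<in> I \<Longrightarrow> h i \<in> mpolys F V" for I :: "(nat \<Rightarrow>\<^sub>0 nat) set" and h
    using that by (induction I rule: infinite_finite_induct) (auto simp: zero add)
  show ?thesis
  proof
    show "0 \<in> mpolys F V" by (rule zero)
    show "1 \<in> mpolys F V"
      using single_mpolys[of 1 F 0 V] F by simp
  next
    fix p q assume pq: "p \<in> mpolys F V" "q \<in> mpolys F V"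
    then show "p + q \<in> mpolys F V" by (rule add)
    have "p * q = (\<Sum>m\<in>Poly_Mapping.keys p. \<Sum>m'\<in>Poly_Mapping.keys q.
        Poly_Mapping.single (m + m') (Poly_Mapping.lookup p m * Poly_Mapping.lookup q m'))"
      by (subst sum_of_monomials[of p], subst sum_of_monomials[of q])
         (simp add: sum_product mult_single)
    also have "\<dots> \<in> mpolys F V"
    proof (intro sum single_mpolys)
      fix m m' assume "m \<in> Poly_Mapping.keys p" "m' \<in> Poly_Mapping.keys q"
      then show "Poly_Mapping.keys (m + m') \<subseteq> V"
        using pq keys_add[of m m'] unfolding mpolys_def by blast
      show "Poly_Mapping.lookup p m * Poly_Mapping.lookup q m' \<in> F"
        using pq F by (simp add: mpolys_def)
    qed (rule F(1))
    finally show "p * q \<in> mpolys F V" .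
  next
    fix p assume "p \<in> mpolys F V"
    then show "- p \<in> mpolys F V" using F(5) by (simp add: mpolys_def)
  qed
qed

lemma mpolys_induct [consumes 2, case_names const var add mult]:
  assumes p: "p \<in> mpolys F V" and F0: "0 \<in> F"
    and const: "\<And>a. a \<in> F \<Longrightarrow> Q (Poly_Mapping.single 0 a)"
    and var: "\<And>i. i \<in> V \<Longrightarrow> Q (var i)"
    and add: "\<And>p q. Q p \<Longrightarrow> Q q \<Longrightarrow> Q (p + q)"
    and mult: "\<And>p q. Q p \<Longrightarrow> Q q \<Longrightarrow> Q (p * q)"
  shows "Q p"
proof -
  have monomial: "Q (Poly_Mapping.single m a)" if "a \<in> F" "Poly_Mapping.keys m \<subseteq> V" for m a
    using that(2)
  proof (induction "\<Sum>i\<in>Poly_Mapping.keys m. Poly_Mapping.lookup m i" arbitrary: m rule: less_induct)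
    case less
    show ?case
    proof (cases "m = 0")
      case True
      then show ?thesis using const that(1) by simp
    next
      case False
      then obtain i where i: "i \<in> Poly_Mapping.keys m" by (meson all_not_in_conv keys_eq_empty)
      define m' where "m' = m - Poly_Mapping.single i 1"
      have "Poly_Mapping.lookup m i \<noteq> 0" using i by (simp add: in_keys_iff)
      then have m: "m = m' + Poly_Mapping.single i 1"
        unfolding m'_def
        by (intro poly_mapping_eqI) (auto simp: lookup_add lookup_minus lookup_single when_def)
      have keys: "Poly_Mapping.keys m' \<subseteq> Poly_Mapping.keys m"
        unfolding m'_def by (auto simp: in_keys_iff lookup_minus)
      have "(\<Sum>l\<in>Poly_Mapping.keys m'. Poly_Mapping.lookup m' l) = (\<Sum>l\<in>Poly_Mapping.keys m. Poly_Mapping.lookup m' l)"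
        using keys by (intro sum.mono_neutral_left) (auto simp: in_keys_iff)
      also have "\<dots> < (\<Sum>l\<in>Poly_Mapping.keys m. Poly_Mapping.lookup m l)"
      proof (rule sum_strict_mono_ex1)
        show "\<exists>l\<in>Poly_Mapping.keys m. Poly_Mapping.lookup m' l < Poly_Mapping.lookup m l"
          using i m by (intro bexI[of _ i]) (simp_all add: lookup_add)
      qed (simp_all add: m'_def lookup_minus)
      finally have "Q (Poly_Mapping.single m' a)"
        using less.hyps keys less.prems by blast
      then have "Q (Poly_Mapping.single m' a * var i)"
        using var i less.prems by (intro mult) auto
      then show ?thesis unfolding var_def mult_single using m by simp
    qed
  qed
  have zero: "Q 0" using const[OF F0] by simp
  have "Q (\<Sum>m\<in>I. Poly_Mapping.single m (Poly_Mapping.lookup p m))"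
    if "finite I" "I \<subseteq> Poly_Mapping.keys p" for I
    using that
  proof (induction I)
    case (insert m I)
    then show ?case using p
      by (auto simp: mpolys_def intro!: add monomial)
  qed (use zero in simp)
  from this[of "Poly_Mapping.keys p"] show ?thesis by (simp flip: sum_of_monomials)
qed

lemma mpolys_mono: "V \<subseteq> W \<Longrightarrow> mpolys F V \<subseteq> mpolys F W"
  by (auto simp: mpolys_def)

text \<open>
  Multiplication by a variable shifts exponents.
\<close>

lemma lookup_var_mult: "Poly_Mapping.lookup (var n * q) (Poly_Mapping.single n 1 + m) = Poly_Mapping.lookup q m"
proof -
  have "var n * q = (\<Sum>k\<in>Poly_Mapping.keys q.
      Poly_Mapping.single (Poly_Mapping.single n 1 + k) (Poly_Mapping.lookup q k))"
    unfolding var_def by (subst sum_of_monomials[of q]) (simp add: sum_distrib_left mult_single)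
  then have "Poly_Mapping.lookup (var n * q) (Poly_Mapping.single n 1 + m) =
      (\<Sum>k\<in>Poly_Mapping.keys q. Poly_Mapping.lookup (Poly_Mapping.single k (Poly_Mapping.lookup q k)) m)"
    by (simp add: lookup_sum lookup_single)
  also have "\<dots> = Poly_Mapping.lookup q m"
    by (subst (3) sum_of_monomials[of q]) (simp add: lookup_sum)
  finally show ?thesis .
qed

lemma lookup_var_mult_zero:
  assumes "Poly_Mapping.lookup m n = 0"
  shows "Poly_Mapping.lookup (var n * q) m = 0"
proof (rule ccontr)
  assume "Poly_Mapping.lookup (var n * q) m \<noteq> 0"
  then have "m \<in> Poly_Mapping.keys (var n * q)" by (simp add: in_keys_iff)
  then obtain k where "m = Poly_Mapping.single n 1 + k"
    using keys_mult[of "var n" q] by (auto simp: var_def)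
  with assms show False by (simp add: lookup_add)
qed

text \<open>
  The coefficient of a monomial \<open>m\<close> is found by separating \<open>m\<close> into its power of \<open>\<alpha>\<^sub>n\<close>, which selects
  a coefficient of \<open>A\<close>, and the remaining monomial, which does not involve \<open>\<alpha>\<^sub>n\<close>. Injectivity of
  evaluation at \<open>\<alpha>\<^sub>n\<close> and the formula for the degree both follow.
\<close>

lemma lookup_eval_var:
  assumes "n \<notin> V" "A \<in> polys_over (mpolys F V)"
  shows "Poly_Mapping.lookup (poly A (var n)) m =
    Poly_Mapping.lookup (coeff A (Poly_Mapping.lookup m n)) (m - Poly_Mapping.single n (Poly_Mapping.lookup m n))"
  using assms(2)
proof (induction A arbitrary: m)
  case (pCons a A)
  have coeffs: "coeff (pCons a A) i \<in> mpolys F V" for i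
    using pCons.prems unfolding polys_over_def by blast
  have a: "a \<in> mpolys F V" using coeffs[of 0] by simp
  have A: "A \<in> polys_over (mpolys F V)"
    using coeffs[of "Suc _"] by (simp add: polys_over_def)
  show ?case
  proof (cases "Poly_Mapping.lookup m n")
    case 0
    then show ?thesis by (simp add: lookup_add lookup_var_mult_zero)
  next
    case (Suc l)
    have "Poly_Mapping.lookup a m = 0"
    proof (rule ccontr)
      assume "Poly_Mapping.lookup a m \<noteq> 0"
      then have "Poly_Mapping.keys m \<subseteq> V" using a by (simp add: mpolys_def in_keys_iff)
      moreover have "n \<in> Poly_Mapping.keys m" using Suc by (simp add: in_keys_iff)
      ultimately show False using assms(1) by blast
    qed
    define m' where "m' = m - Poly_Mapping.single n 1"
    have m: "m = Poly_Mapping.single n 1 + m'"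
      unfolding m'_def using Suc
      by (intro poly_mapping_eqI) (auto simp: lookup_add lookup_minus lookup_single when_def)
    have l: "Poly_Mapping.lookup m' n = l" using Suc by (simp add: m'_def lookup_minus)
    have rest: "m' - Poly_Mapping.single n l = m - Poly_Mapping.single n (Suc l)"
      by (intro poly_mapping_eqI) (auto simp: m'_def lookup_minus lookup_single when_def)
    have "Poly_Mapping.lookup (poly (pCons a A) (var n)) m = Poly_Mapping.lookup (var n * poly A (var n)) m"
      using \<open>Poly_Mapping.lookup a m = 0\<close> by (simp add: lookup_add)
    also have "\<dots> = Poly_Mapping.lookup (poly A (var n)) m'"
      unfolding m by (rule lookup_var_mult)
    also have "\<dots> = Poly_Mapping.lookup (coeff A l) (m - Poly_Mapping.single n (Suc l))"
      unfolding pCons.IH[OF A] l rest ..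
    finally show ?thesis using Suc by simp
  qed
qed simp

lemma lookup_eval_var_shift:
  assumes "n \<notin> V" "A \<in> polys_over (mpolys F V)" "m \<in> Poly_Mapping.keys (coeff A i)"
  shows "Poly_Mapping.lookup (m + Poly_Mapping.single n i) n = i"
    and "m + Poly_Mapping.single n i \<in> Poly_Mapping.keys (poly A (var n))"
proof -
  have "coeff A i \<in> mpolys F V" using assms(2) unfolding polys_over_def by blast
  then have "Poly_Mapping.keys m \<subseteq> V" using assms(3) by (simp add: mpolys_def)
  then have "Poly_Mapping.lookup m n = 0" using assms(1) by (auto simp: in_keys_iff)
  then show l: "Poly_Mapping.lookup (m + Poly_Mapping.single n i) n = i" by (simp add: lookup_add)
  show "m + Poly_Mapping.single n i \<in> Poly_Mapping.keys (poly A (var n))"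
    using assms(3) unfolding in_keys_iff lookup_eval_var[OF assms(1,2)] l by simp
qed

lemma eval_var_eq_zero:
  assumes "n \<notin> V" "A \<in> polys_over (mpolys F V)" "poly A (var n) = 0"
  shows "A = 0"
proof (rule poly_eqI)
  fix i
  have "Poly_Mapping.keys (coeff A i) = {}"
  proof (rule equals0I)
    fix m assume "m \<in> Poly_Mapping.keys (coeff A i)"
    from lookup_eval_var_shift(2)[OF assms(1,2) this] assms(3) show False by simp
  qed
  then show "coeff A i = coeff 0 i" by simp
qed

lemma deg_var_eval_var:
  assumes "n \<notin> V" "A \<in> polys_over (mpolys F V)" "A \<noteq> 0"
  shows "deg_var n (poly A (var n)) = ereal (real (Polynomial.degree A))"
proof -
  let ?p = "poly A (var n)"
  have "Max ((\<lambda>m. Poly_Mapping.lookup m n) ` Poly_Mapping.keys ?p) = Polynomial.degree A"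
  proof (rule Max_eqI)
    fix y assume "y \<in> (\<lambda>m. Poly_Mapping.lookup m n) ` Poly_Mapping.keys ?p"
    then obtain m where m: "m \<in> Poly_Mapping.keys ?p" "y = Poly_Mapping.lookup m n" by blast
    then have "coeff A y \<noteq> 0"
      unfolding in_keys_iff lookup_eval_var[OF assms(1,2)] by auto
    then show "y \<le> Polynomial.degree A" by (rule le_degree)
  next
    have "lead_coeff A \<noteq> 0" using assms(3) by simp
    then obtain m where m: "m \<in> Poly_Mapping.keys (lead_coeff A)"
      by (meson all_not_in_conv keys_eq_empty)
    show "Polynomial.degree A \<in> (\<lambda>m. Poly_Mapping.lookup m n) ` Poly_Mapping.keys ?p"
      using lookup_eval_var_shift[OF assms(1,2) m] by (intro image_eqI) auto
  qed simp
  moreover have "?p \<noteq> 0" using eval_var_eq_zero[OF assms(1,2)] assms(3) by blast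
  ultimately show ?thesis by (simp add: deg_var_def)
qed

lemma mpolys_insert:
  assumes F: "subfield_of_Qbar F"
  shows "mpolys F (insert n V) = (\<lambda>A. poly A (var n)) ` polys_over (mpolys F V)"
proof -
  interpret V: subring "mpolys F V" by (rule subring_mpolys[OF F])
  interpret W: subring "mpolys F (insert n V)" by (rule subring_mpolys[OF F])
  interpret S: subring "polys_over (mpolys F V)" by (rule V.subring_polys_over)
  note FF = subfield_of_Qbar_closed[OF F]
  let ?I = "(\<lambda>A. poly A (var n)) ` polys_over (mpolys F V)"
  have constI: "p \<in> ?I" if "p \<in> mpolys F V" for p
    using that by (intro image_eqI[of _ _ "[:p:]"]) (simp_all add: V.const_polys_over)
  show ?thesis
  proof (intro subset_antisym subsetI)
    fix p assume "p \<in> mpolys F (insert n V)"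
    then show "p \<in> ?I"
      using FF(1)
    proof (induction rule: mpolys_induct)
      case (const a)
      then show ?case using single_mpolys[of a F 0 V] FF(1) by (intro constI) simp
    next
      case (var i)
      show ?case
      proof (cases "i = n")
        case True
        have "[:0, 1:] \<in> polys_over (mpolys F V)"
          by (simp add: V.pCons_polys_over V.const_polys_over del: One_nat_def)
        then show ?thesis using True by (intro image_eqI[of _ _ "[:0, 1:]"]) simp_all
      next
        case False
        then show ?thesis using var var_mpolys[OF FF(1,2)] by (intro constI) blast
      qed
    next
      case (add p q)
      then obtain A B where "A \<in> polys_over (mpolys F V)" "B \<in> polys_over (mpolys F V)"
        "p = poly A (var n)" "q = poly B (var n)" by blast
      then show ?case by (intro image_eqI[of _ _ "A + B"]) simp_all
    next
      case (mult p q)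
      then obtain A B where "A \<in> polys_over (mpolys F V)" "B \<in> polys_over (mpolys F V)"
        "p = poly A (var n)" "q = poly B (var n)" by blast
      then show ?case by (intro image_eqI[of _ _ "A * B"]) simp_all
    qed
  next
    fix p assume "p \<in> ?I"
    then obtain A where A: "A \<in> polys_over (mpolys F V)" "p = poly A (var n)" by blast
    have "poly A (var n) \<in> mpolys F (insert n V)"
      using A(1)
    proof (induction A)
      case (pCons a A)
      then have "a \<in> mpolys F (insert n V)" "A \<in> polys_over (mpolys F V)"
        using V.pCons_polys_over mpolys_mono[of V "insert n V" F] by blast+
      with pCons.IH show ?case using var_mpolys[OF FF(1,2), of n "insert n V"] by simp
    qed simp
    with A show "p \<in> mpolys F (insert n V)" by simp
  qed
qed

lemma to_rf_hom: "to_rf 0 = 0" "to_rf 1 = 1" "to_rf (p + q) = to_rf p + to_rf q"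
  "to_rf (p * q) = to_rf p * to_rf q" "to_rf p = 0 \<longleftrightarrow> p = 0"
  by (simp_all add: to_rf_def Zero_fract_def One_fract_def eq_fract)

lemma to_rf_eq_iff: "to_rf p = to_rf q \<longleftrightarrow> p = q"
  by (simp add: to_rf_def eq_fract)

lemma to_rf_poly: "to_rf (poly A y) = poly (map_poly to_rf A) (to_rf y)"
  by (induction A) (simp_all add: to_rf_hom map_poly_pCons)

lemma polys_over_to_rf: "polys_over (to_rf ` M) = map_poly to_rf ` polys_over M" if "0 \<in> M"
proof (intro subset_antisym subsetI)
  fix B assume B: "B \<in> polys_over (to_rf ` M)"
  define h where "h = inv to_rf"
  have h: "h (to_rf p) = p" for p
    unfolding h_def by (rule inv_f_f) (simp add: inj_on_def to_rf_eq_iff)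
  have h0: "h 0 = 0" using h[of 0] by (simp add: to_rf_hom)
  have c: "coeff B i \<in> to_rf ` M" for i using B unfolding polys_over_def by blast
  have hc: "to_rf (h (coeff B i)) = coeff B i" "h (coeff B i) \<in> M" for i
    using c[of i] h by auto
  have "B = map_poly to_rf (map_poly h B)"
    by (rule poly_eqI) (simp add: coeff_map_poly to_rf_hom h0 hc)
  moreover have "map_poly h B \<in> polys_over M"
    by (simp add: polys_over_def coeff_map_poly h0 hc)
  ultimately show "B \<in> map_poly to_rf ` polys_over M" by blast
qed (auto simp: polys_over_def coeff_map_poly to_rf_hom)

lemma to_rf_mpolys_insert:
  assumes F: "subfield_of_Qbar F"
  shows "to_rf ` mpolys F (insert n V) =
    (\<lambda>A. poly A (to_rf (var n))) ` polys_over (to_rf ` mpolys F V)"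
proof -
  have "0 \<in> mpolys F V" using subring.zero_closed[OF subring_mpolys[OF F]] .
  then show ?thesis
    by (simp add: mpolys_insert[OF F] polys_over_to_rf image_image to_rf_poly)
qed

lemma transcendental_var:
  assumes F: "subfield_of_Qbar F" and "n \<notin> V"
    and A: "A \<in> polys_over (to_rf ` mpolys F V)" "poly A (to_rf (var n)) = 0"
  shows "A = 0"
proof -
  have "0 \<in> mpolys F V" using subring.zero_closed[OF subring_mpolys[OF F]] .
  then obtain B where B: "B \<in> polys_over (mpolys F V)" "A = map_poly to_rf B"
    using A(1) by (auto simp: polys_over_to_rf)
  with A(2) have "poly B (var n) = 0" by (simp flip: to_rf_poly add: to_rf_hom)
  with eval_var_eq_zero[OF assms(2) B(1)] B(2) show ?thesis by simp
qed

lemma ratfuns_eq_fractions: "ratfuns F V = fractions (to_rf ` mpolys F V)"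
proof -
  have quotient: "Fract p q = to_rf p / to_rf q" for p q by (simp add: to_rf_def)
  show ?thesis
  proof (intro subset_antisym subsetI)
    fix y assume "y \<in> ratfuns F V"
    then obtain p q where "p \<in> mpolys F V" "q \<in> mpolys F V" "q \<noteq> 0" "y = Fract p q"
      unfolding ratfuns_def by blast
    then show "y \<in> fractions (to_rf ` mpolys F V)"
      unfolding quotient by (simp add: fractionsI to_rf_hom)
  next
    fix y assume "y \<in> fractions (to_rf ` mpolys F V)"
    then obtain p q where "p \<in> mpolys F V" "q \<in> mpolys F V" "to_rf q \<noteq> 0" "y = Fract p q"
      unfolding quotient by (blast elim: fractionsE)
    then show "y \<in> ratfuns F V"
      unfolding ratfuns_def by (auto simp: to_rf_hom)
  qed
qed

text \<open>
  Induction on the number of variables. The units are tracked along the way, because an associate of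
  \<open>d\<close> has to be a multiple of \<open>d\<close> by an element of \<open>F\<close>.
\<close>

lemma factorial_mpolys:
  assumes F: "subfield_of_Qbar F" and "finite V"
  shows "factorial_subring (to_rf ` mpolys F V) \<and>
    (\<forall>w. unit_in (to_rf ` mpolys F V) w \<longrightarrow> w \<in> const_rf ` F)"
  using assms(2)
proof (induction V)
  case empty
  note FF = subfield_of_Qbar_closed[OF F]
  have "mpolys F {} = (Poly_Mapping.single 0 :: complex \<Rightarrow> cmpoly) ` F"
  proof (intro subset_antisym subsetI)
    fix p assume "p \<in> mpolys F {}"
    then have "p \<in> mpolys F {}" "0 \<in> F" using FF by auto
    then show "p \<in> (Poly_Mapping.single 0 :: complex \<Rightarrow> cmpoly) ` F"
    proof (induction rule: mpolys_induct)
      case (add p q)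
      then obtain a b where "a \<in> F" "b \<in> F" "p = Poly_Mapping.single 0 a" "q = Poly_Mapping.single 0 b"
        by blast
      then show ?case using FF(3) by (intro image_eqI[of _ _ "a + b"]) (simp_all add: single_add)
    next
      case (mult p q)
      then obtain a b where "a \<in> F" "b \<in> F" "p = Poly_Mapping.single 0 a" "q = Poly_Mapping.single 0 b"
        by blast
      then show ?case using FF(4) by (intro image_eqI[of _ _ "a * b"]) (simp_all add: mult_single)
    qed auto
  next
    fix p assume "p \<in> (Poly_Mapping.single 0 :: complex \<Rightarrow> cmpoly) ` F"
    then show "p \<in> mpolys F {}" using single_mpolys[of _ F 0 "{}"] FF(1) by auto
  qed
  then have R: "to_rf ` mpolys F {} = const_rf ` F" by (simp add: const_rf_def image_image)
  have unit: "unit_in (to_rf ` mpolys F {}) w" if "w \<in> to_rf ` mpolys F {}" "w \<noteq> 0" for w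
  proof -
    from that obtain a where a: "a \<in> F" "w = const_rf a" unfolding R by blast
    with that(2) have "a \<noteq> 0" by (auto simp: const_rf_def to_rf_hom)
    then have "w * const_rf (inverse a) = 1"
      by (simp add: a const_rf_def mult_single to_rf_hom flip: to_rf_hom(4))
    with a FF(6) show ?thesis unfolding unit_in_def R by blast
  qed
  have "subring (to_rf ` mpolys F {})"
  proof -
    interpret subring_embedding "mpolys F {}" to_rf
      by (intro subring_embedding.intro subring_mpolys[OF F] subring_embedding_axioms.intro)
         (simp_all add: to_rf_hom)
    show ?thesis by (rule subring_image)
  qed
  then have "factorial_subring (to_rf ` mpolys F {})"
  proof (intro factorial_subring.intro factorial_subring_axioms.intro)
    show "\<exists>\<Omega>::cratfun \<Rightarrow> nat.
      (\<forall>a\<in>to_rf ` mpolys F {} - {0}. \<forall>b\<in>to_rf ` mpolys F {} - {0}. \<Omega> (a * b) = \<Omega> a + \<Omega> b) \<and>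
      (\<forall>a\<in>to_rf ` mpolys F {} - {0}. \<Omega> a = 0 \<longleftrightarrow> unit_in (to_rf ` mpolys F {}) a)"
      by (rule exI[of _ "\<lambda>_. 0"]) (simp add: unit)
  next
    fix p a b assume "irreducible_in (to_rf ` mpolys F {}) p"
    then show "dvd_in (to_rf ` mpolys F {}) p a \<or> dvd_in (to_rf ` mpolys F {}) p b"
      using unit unfolding irreducible_in_def by blast
  qed
  then show ?case unfolding R by (auto simp: unit_in_def)
next
  case (insert n V)
  let ?R = "to_rf ` mpolys F V" and ?x = "to_rf (var n)"
  interpret factorial_subring ?R using insert.IH by blast
  have emb: "subring_embedding (polys_over ?R) (\<lambda>A. poly A ?x)"
    by (intro subring_embedding.intro subring_polys_over subring_embedding_axioms.intro)
       (simp_all add: transcendental_var[OF F insert.hyps(2)])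
  have "factorial_subring (to_rf ` mpolys F (insert n V))"
    unfolding to_rf_mpolys_insert[OF F] by (intro factorial_image factorial_polys_over emb)
  moreover have "w \<in> const_rf ` F" if w: "unit_in (to_rf ` mpolys F (insert n V)) w" for w
  proof -
    from w have "w \<in> to_rf ` mpolys F (insert n V)" by (simp add: unit_in_def)
    then obtain A where A: "A \<in> polys_over ?R" "w = poly A ?x"
      unfolding to_rf_mpolys_insert[OF F] by blast
    with w have "unit_in (polys_over ?R) A"
      using subring_embedding.unit_in_image[OF emb A(1)] unfolding to_rf_mpolys_insert[OF F] by simp
    then obtain v where "unit_in ?R v" "A = [:v:]"
      using unit_in_polys_over[OF subring_axioms] by blast
    with insert.IH A(2) show ?thesis by simp
  qed
  ultimately show ?case by blast
qed

section \<open>The summability criterion\<close>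

lemma const_rf_hom: "const_rf (a * b) = const_rf a * const_rf b" "const_rf 1 = 1" "const_rf 0 = 0"
  by (simp_all add: const_rf_def mult_single flip: to_rf_hom)

lemma const_rf_power: "const_rf (a ^ m) = const_rf a ^ m"
  by (induction m) (simp_all add: const_rf_hom)

lemma const_rf_inverse: "a \<noteq> 0 \<Longrightarrow> const_rf (inverse a) = inverse (const_rf a)"
  using const_rf_hom(1)[of a "inverse a"] by (intro inverse_unique[symmetric]) (simp add: const_rf_hom)

lemma const_rf_eq_zero: "const_rf a = 0 \<longleftrightarrow> a = 0"
proof -
  have "Poly_Mapping.single 0 a = (0 :: cmpoly) \<longleftrightarrow> a = 0"
    by (metis lookup_single_eq lookup_zero single_zero)
  then show ?thesis by (simp add: const_rf_def to_rf_hom)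
qed

lemma subfield_automorphism_ratfuns:
  assumes F: "subfield_of_Qbar F" and \<sigma>: "scaling_automorphism F n lam \<sigma>"
  shows "subfield_automorphism (ratfuns F {1..n}) \<sigma>"
proof -
  have "subring (to_rf ` mpolys F {1..n})"
    using factorial_mpolys[OF F, of "{1..n}"] by (simp add: factorial_subring_def)
  then interpret subring "ratfuns F {1..n}"
    unfolding ratfuns_eq_fractions by (rule subring_fractions)
  show ?thesis
  proof
    fix y assume "y \<in> ratfuns F {1..n}"
    then obtain p q where q: "p \<in> to_rf ` mpolys F {1..n}" "q \<in> to_rf ` mpolys F {1..n}" "q \<noteq> 0" "y = p / q"
      unfolding ratfuns_eq_fractions by (rule fractionsE)
    show "inverse y \<in> ratfuns F {1..n}"
    proof (cases "p = 0")
      case False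
      then show ?thesis using q unfolding ratfuns_eq_fractions by (simp add: fractionsI)
    qed (simp add: q(4) del: One_nat_def)
  qed (use \<sigma> in \<open>simp_all add: scaling_automorphism_def del: One_nat_def\<close>)
qed

text \<open>
  A polynomial ring is generated by constants and variables, and up to nonzero constants \<open>\<sigma>\<close> fixes
  these; so no explicit formula for \<open>\<sigma>\<close> is needed. Surjectivity matters: it makes \<open>\<sigma>\<close> preserve
  irreducibility.
\<close>

lemma scaling_automorphism_image:
  assumes F: "subfield_of_Qbar F" and \<sigma>: "scaling_automorphism F n lam \<sigma>"
    and lam: "\<And>i. i \<in> {1..n} \<Longrightarrow> lam i \<in> F - {0}" and V: "V \<subseteq> {1..n}"
  shows "\<sigma> ` to_rf ` mpolys F V = to_rf ` mpolys F V"
proof -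
  interpret subfield_automorphism "ratfuns F {1..n}" \<sigma>
    by (rule subfield_automorphism_ratfuns[OF F \<sigma>])
  note FF = subfield_of_Qbar_closed[OF F]
  interpret V: subring "mpolys F V" by (rule subring_mpolys[OF F])
  have L: "to_rf p \<in> ratfuns F {1..n}" if "p \<in> mpolys F V" for p
  proof -
    have "1 \<in> mpolys F {1..n}" using subring.one_closed[OF subring_mpolys[OF F]] .
    moreover have "p \<in> mpolys F {1..n}" using that mpolys_mono[OF V] by blast
    ultimately show ?thesis
      unfolding ratfuns_def to_rf_def by (intro CollectI exI[of _ p] exI[of _ 1]) simp
  qed
  have const_image: "\<sigma> (const_rf a) = const_rf a" "Poly_Mapping.single 0 a \<in> mpolys F V" if "a \<in> F" for a
    using \<sigma> that single_mpolys[of a F 0 V] FF(1) by (simp_all add: scaling_automorphism_def)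
  let ?T = "to_rf ` mpolys F V"
  have TL: "y \<in> ratfuns F {1..n}" if "y \<in> ?T" for y using that L by blast
  interpret T: subring ?T
    by (intro subring_embedding.subring_image subring_embedding.intro V.subring_axioms
        subring_embedding_axioms.intro) (simp_all add: to_rf_hom)
  have "p \<in> mpolys F V \<and> \<sigma> (to_rf p) \<in> ?T \<and> (\<exists>y\<in>?T. to_rf p = \<sigma> y)"
    if "p \<in> mpolys F V" for p
    using that FF(1)
  proof (induction rule: mpolys_induct)
    case (const a)
    then show ?case using const_image[of a] unfolding const_rf_def by (metis image_eqI)
  next
    case (var i)
    then have i: "i \<in> {1..n}" using V by blast
    have \<sigma>_var: "\<sigma> (to_rf (var i)) = const_rf (lam i) * to_rf (var i)"
      using \<sigma> i by (simp add: scaling_automorphism_def)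
    have lam_i: "lam i \<in> F" "lam i \<noteq> 0" using lam[OF i] by auto
    then have inv: "inverse (lam i) \<in> F" using FF(6) by blast
    have v: "var i \<in> mpolys F V" using var var_mpolys FF(1,2) by blast
    have T: "const_rf (lam i) \<in> ?T" "const_rf (inverse (lam i)) \<in> ?T" "to_rf (var i) \<in> ?T"
      using const_image(2) lam_i(1) inv v unfolding const_rf_def by blast+
    have "\<sigma> (const_rf (inverse (lam i)) * to_rf (var i)) =
        const_rf (inverse (lam i)) * (const_rf (lam i) * to_rf (var i))"
      using hom_mult[OF TL[OF T(2)] TL[OF T(3)]] const_image(1)[OF inv] by (simp add: \<sigma>_var)
    also have "\<dots> = to_rf (var i)"
      using lam_i by (simp add: const_rf_inverse const_rf_eq_zero)
    finally have "to_rf (var i) = \<sigma> (const_rf (inverse (lam i)) * to_rf (var i))" ..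
    then show ?case
      using T v \<sigma>_var T.mult_closed by metis
  next
    case (add p q)
    then obtain y z where "y \<in> ?T" "z \<in> ?T" "to_rf p = \<sigma> y" "to_rf q = \<sigma> z" by blast
    moreover from this have "\<sigma> (y + z) = to_rf (p + q)" using L by (auto simp: hom_add to_rf_hom)
    moreover have "\<sigma> (to_rf (p + q)) = \<sigma> (to_rf p) + \<sigma> (to_rf q)"
      using add.IH L by (simp add: hom_add to_rf_hom)
    ultimately show ?case using add.IH T.add_closed V.add_closed by metis
  next
    case (mult p q)
    then obtain y z where "y \<in> ?T" "z \<in> ?T" "to_rf p = \<sigma> y" "to_rf q = \<sigma> z" by blast
    moreover from this have "\<sigma> (y * z) = to_rf (p * q)" using L by (auto simp: hom_mult to_rf_hom)
    moreover have "\<sigma> (to_rf (p * q)) = \<sigma> (to_rf p) * \<sigma> (to_rf q)"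
      using mult.IH L by (simp add: hom_mult to_rf_hom)
    ultimately show ?case using mult.IH T.mult_closed V.mult_closed by metis
  qed
  then show ?thesis by blast
qed

theorem theorem3p7:
  fixes F :: "complex set" and n j k :: nat and lam :: "nat \<Rightarrow> complex"
    and \<sigma> :: "cratfun \<Rightarrow> cratfun" and c u \<epsilon> :: complex
    and d :: cmpoly and A :: "cratfun poly" and a f :: cratfun
  assumes "subfield_of_Qbar F" and "n \<ge> 1"
    and "\<And>i. i \<in> {1..n} \<Longrightarrow> lam i \<in> F - {0}"
    and "scaling_automorphism F n lam \<sigma>"
    and "c \<in> F - {0}" and "j \<ge> 1"
    and "irreducible_in (mpolys F {1..n}) d"
    and "\<not> sigma_equivalent F n \<sigma> d (var n)"
    and "A \<in> upolys F n" and "a = poly A (to_rf (var n))"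
    and "deg A < deg_var n d"
    and "f = a / to_rf d ^ j"
    and "k \<ge> 1" and "Spr F n \<sigma> d d = {int k * m | m. True}"
    and "u \<in> F - {0}" and "(\<sigma> ^^ k) (to_rf d) = const_rf u * to_rf d"
    and "\<epsilon> = c ^ k * u powi (- int j)"
  shows "csigma_summable F n \<sigma> c f \<longleftrightarrow>
    (\<exists>B \<in> upolys F n. deg B < deg_var n d \<and>
       a = const_rf \<epsilon> * (\<sigma> ^^ k) (poly B (to_rf (var n))) - poly B (to_rf (var n)))"
proof -
  note F = assms(1) and lam = assms(3) and \<sigma> = assms(4) and period = assms(16)
  let ?R = "to_rf ` mpolys F {1..<n}" and ?x = "to_rf (var n)" and ?P = "to_rf ` mpolys F {1..n}"
  have c: "c \<in> F" and u: "u \<in> F" "u \<noteq> 0" using assms(5,15) by auto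
  have insert: "{1..n} = insert n {1..<n}" using assms(2) by auto
  have P: "?P = (\<lambda>A. poly A ?x) ` polys_over ?R"
    unfolding insert by (rule to_rf_mpolys_insert[OF F])
  have L: "ratfuns F {1..n} = fractions ((\<lambda>A. poly A ?x) ` polys_over ?R)"
    unfolding ratfuns_eq_fractions P ..
  have K: "upolys F n = polys_over (fractions ?R)"
    unfolding upolys_def polys_over_def ratfuns_eq_fractions ..
  interpret \<sigma>: subfield_automorphism "ratfuns F {1..n}" \<sigma>
    by (rule subfield_automorphism_ratfuns[OF F \<sigma>])
  interpret R: factorial_subring ?R
    using factorial_mpolys[OF F, of "{1..<n}"] by simp
  have d: "d \<in> mpolys F {1..n}" "d \<noteq> 0" using assms(7) by (auto simp: irreducible_in_def)
  obtain D0 where D0: "D0 \<in> polys_over (mpolys F {1..<n})" "d = poly D0 (var n)"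
    using d(1) unfolding insert mpolys_insert[OF F] by blast
  define D where "D = map_poly to_rf D0"
  have D: "D \<in> polys_over ?R" "poly D ?x = to_rf d"
    using D0(1) unfolding D_def D0(2) to_rf_poly
    by (simp_all add: polys_over_def coeff_map_poly to_rf_hom)
  have "D0 \<noteq> 0" using D0(2) d(2) by auto
  have "Polynomial.degree D = Polynomial.degree D0"
    unfolding D_def by (rule degree_map_poly) (simp add: to_rf_hom)
  then have deg_d: "deg_var n d = ereal (real (Polynomial.degree D))"
    using deg_var_eval_var[OF _ D0(1) \<open>D0 \<noteq> 0\<close>] D0(2) by simp
  show ?thesis
  proof (cases "Polynomial.degree D = 0")
    case True
    \<comment> \<open>If \<open>d\<close> does not involve \<open>\<alpha>\<^sub>n\<close>, the degree bound leaves only zero for \<open>a\<close> and for \<open>b\<close>.\<close>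
    have zero: "B = 0" if "deg B < deg_var n d" for B
      using that True unfolding deg_d deg_def by (auto split: if_splits)
    then have "A = 0" using assms(11) by blast
    have iterate_zero: "(\<sigma> ^^ k) 0 = 0" by (induction k) (simp_all add: \<sigma>.hom_zero)
    have "csigma_summable F n \<sigma> c f"
      unfolding csigma_summable_def
      by (rule bexI[of _ 0]) (simp_all add: assms(10,12) \<open>A = 0\<close> \<sigma>.hom_zero del: One_nat_def)
    moreover have "0 \<in> upolys F n"
      unfolding K using subring.zero_closed[OF subring_fractions[OF R.subring_axioms]]
      by (simp add: polys_over_def del: One_nat_def)
    ultimately show ?thesis
      using assms(10,11) \<open>A = 0\<close> iterate_zero by (auto intro!: bexI[of _ 0])
  next
    case False
    have transcendental: "B = 0" if "B \<in> polys_over ?R" "poly B ?x = 0" for B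
      by (rule transcendental_var[OF F _ that]) simp
    have emb_d: "subring_embedding (mpolys F {1..n}) to_rf"
      by (intro subring_embedding.intro subring_mpolys[OF F] subring_embedding_axioms.intro)
         (simp_all add: to_rf_hom)
    have emb_D: "subring_embedding (polys_over ?R) (\<lambda>A. poly A ?x)"
      by (intro subring_embedding.intro R.subring_polys_over subring_embedding_axioms.intro)
         (simp_all add: transcendental)
    have "irreducible_in ?P (to_rf d)"
      using subring_embedding.irreducible_in_image[OF emb_d d(1)] assms(7) by blast
    then have irr: "irreducible_in (polys_over ?R) D"
      using subring_embedding.irreducible_in_image[OF emb_D D(1)] unfolding D(2) P by blast
    have C: "const_rf ` F \<subseteq> ?R"
      using single_mpolys[of _ F 0 "{1..<n}"] subfield_of_Qbar_closed(1)[OF F]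
      unfolding const_rf_def by auto
    have "1 \<in> mpolys F {1..n}" using subring.one_closed[OF subring_mpolys[OF F]] .
    then have dL: "to_rf d \<in> ratfuns F {1..n}"
      unfolding ratfuns_def to_rf_def using d(1) by (intro CollectI exI[of _ d] exI[of _ 1]) simp
    have d0: "to_rf d \<noteq> 0" using d(2) by (simp add: to_rf_hom)
    have not_associate: "(\<sigma> ^^ i) (to_rf d) \<noteq> w * to_rf d"
      if i: "0 < i" "i < k" and w: "w \<in> const_rf ` F" for i w
    proof
      assume eq: "(\<sigma> ^^ i) (to_rf d) = w * to_rf d"
      have "(\<sigma> ^^ i) (to_rf d) \<in> ratfuns F {1..n} \<and> (\<sigma> ^^ i) (to_rf d) \<noteq> 0"
        by (induction i) (use dL d0 in \<open>simp_all add: \<sigma>.hom_closed \<sigma>.hom_eq_zero_iff del: One_nat_def\<close>)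
      with eq have "w \<noteq> 0" by auto
      with w obtain z where z: "z \<in> F - {0}" "w = const_rf z" by (auto simp: const_rf_eq_zero)
      have "int i \<in> Spr F n \<sigma> d d"
        unfolding Spr_def int_iterate_def using eq z by auto
      then obtain m where "int i = int k * m" unfolding assms(14) by blast
      \<comment> \<open>A constant ratio puts \<open>i\<close> into the spread \<open>k\<int>\<close>, but \<open>0 < i < k\<close>.\<close>
      then have "int k dvd int i" by simp
      with i show False by (auto dest: zdvd_imp_le)
    qed
    have lam_n: "const_rf (lam n) \<in> ?R"
      using C lam[of n] assms(2) by auto
    have pole: "scaled_pole ?R ?x D \<sigma> (const_rf (lam n)) (const_rf ` F) (const_rf c) (const_rf u) j k"
    proof (intro scaled_pole.intro coordinate_scaling.intro irreducible_over_subring.intro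
        irreducible_over_subring_axioms.intro coordinate_scaling_axioms.intro
        scaled_pole_axioms.intro)
      show "subfield_automorphism (fractions ((\<lambda>A. poly A ?x) ` polys_over ?R)) \<sigma>"
        using \<sigma>.subfield_automorphism_axioms unfolding L .
      show "\<sigma> ` ?R = ?R"
        by (rule scaling_automorphism_image[OF F \<sigma> lam]) auto
      show "\<sigma> ` (\<lambda>A. poly A ?x) ` polys_over ?R = (\<lambda>A. poly A ?x) ` polys_over ?R"
        unfolding P[symmetric] by (rule scaling_automorphism_image[OF F \<sigma> lam]) auto
      show "\<sigma> ?x = const_rf (lam n) * ?x"
        using \<sigma> assms(2) by (simp add: scaling_automorphism_def)
      show "w \<in> const_rf ` F" if "unit_in ((\<lambda>A. poly A ?x) ` polys_over ?R) w" for w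
        using that factorial_mpolys[OF F, of "{1..n}"] unfolding P by simp
      show "\<sigma> w = w" if "w \<in> const_rf ` F" for w
        using that \<sigma> by (auto simp: scaling_automorphism_def)
      show "(\<sigma> ^^ k) (poly D ?x) = const_rf u * poly D ?x"
        unfolding D(2) by (rule period)
      show "(\<sigma> ^^ i) (poly D ?x) \<noteq> w * poly D ?x" if "0 < i" "i < k" "w \<in> const_rf ` F" for i w
        unfolding D(2) using that by (rule not_associate)
    qed (use irr False transcendental C lam_n c u assms(6,13) R.factorial_subring_axioms
          in \<open>simp_all add: const_rf_eq_zero\<close>)
    then have D_irreducible: "irreducible_over_subring ?R ?x D"
      by (simp only: scaled_pole_def coordinate_scaling_def)
    let ?small = "irreducible_over_subring.small ?R D"
    have small: "?small B \<longleftrightarrow> B \<in> upolys F n \<and> deg B < deg_var n d" for B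
    proof -
      have "(\<forall>i\<ge>Polynomial.degree D. coeff B i = 0) \<longleftrightarrow> deg B < deg_var n d"
      proof (cases "B = 0")
        case False
        then have "lead_coeff B \<noteq> 0" by simp
        then have "(\<forall>i\<ge>Polynomial.degree D. coeff B i = 0) \<longleftrightarrow> Polynomial.degree B < Polynomial.degree D"
          using coeff_eq_0[of B] not_le by (meson order_less_le_trans)
        then show ?thesis using False by (simp add: deg_d deg_def)
      qed (simp add: deg_d deg_def)
      then show ?thesis unfolding irreducible_over_subring.small_def[OF D_irreducible] K by blast
    qed
    have eps: "const_rf \<epsilon> = const_rf c ^ k * inverse (const_rf u) ^ j"
      using u(2) unfolding assms(17)
      by (simp add: const_rf_hom const_rf_power const_rf_inverse power_int_minus flip: power_inverse)
    have "?small A" using small assms(9,11) by blast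
    from scaled_pole.summable_iff[OF pole this] show ?thesis
      unfolding csigma_summable_def L assms(10,12) D(2) eps by (simp only: small Bex_def conj_assoc)
  qed
qed

end
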